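(* Let $n\ge1$ and let $U$ be a depth-$d$ $\mathrm{QAC}^0$ circuit on $n+a$ qubits, with $n$ input qubits and $a$ ancilla qubits initialized in a density operator $\varphi$ on $a$ qubits. Let $p:\{0,1\}^n\to\mathbb R$ be the probability that $U$ outputs $1$, i.e. $p(x)=\mathrm{Tr}\big[(|1\rangle\langle1|\otimes I)\,U(|x\rangle\langle x|\otimes\varphi)U^\dagger\big]$. Then $\deg_\varepsilon(p)=\tilde O\big((n+a)^{1-3^{-d}}\big)$ for $\varepsilon=O(d/n)$.
   Context: For $f:\{0,1\}^n\to\mathbb R$ write $f=\sum_{S\subseteq[n]}\hat f(S)\chi_S$ with $\chi_S(x)=(-1)^{\sum_{i\in S}x_i}$; $\deg(f)=\max\{|S|:\hat f(S)\ne0\}$ and $\deg_\varepsilon(f)=\min\{\deg(g):\max_x|f(x)-g(x)|\le\varepsilon\}$. A depth-$d$ $\mathrm{QAC}^0$ circuit on $m$ qubits is a unitary $U=L_dM_d\cdots L_1M_1L_0$ where each $L_i$ is a tensor product of single-qubit unitaries and each $M_i$ is a tensor product of multi-qubit CZ gates $I-2|1^s\rangle\langle1^s|$ on pairwise disjoint sets of qubits. $O(\cdot)$ hides an absolute constant; $\tilde O(\cdot)$ hides absolute constants and polylogarithmic factors in $n+a$. *)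

theory Defs
  imports "Jordan_Normal_Form.Matrix" "Jordan_Normal_Form.Schur_Decomposition"
    "HOL-Library.Complex_Order"
begin

text \<open>Computational basis states of an m-qubit register are indexed by i < 2^m;
  qubit k of basis state i is bit k of i.\<close>
definition qbit :: "nat \<Rightarrow> nat \<Rightarrow> bool" where
  "qbit i k \<longleftrightarrow> odd (i div 2 ^ k)"

definition unitary_mat :: "nat \<Rightarrow> complex mat \<Rightarrow> bool" where
  "unitary_mat N U \<longleftrightarrow> U \<in> carrier_mat N N \<and> mat_adjoint U * U = 1\<^sub>m N \<and> U * mat_adjoint U = 1\<^sub>m N"

text \<open>Tensor product of single-qubit operators u 0, ..., u (m-1).\<close>
definition single_qubit_layer :: "nat \<Rightarrow> (nat \<Rightarrow> complex mat) \<Rightarrow> complex mat" where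
  "single_qubit_layer m u = mat (2 ^ m) (2 ^ m)
     (\<lambda>(i, j). \<Prod>k<m. u k $$ (if qbit i k then 1 else 0, if qbit j k then 1 else 0))"

definition is_single_qubit_layer :: "nat \<Rightarrow> complex mat \<Rightarrow> bool" where
  "is_single_qubit_layer m L \<longleftrightarrow>
     (\<exists>u. (\<forall>k<m. unitary_mat 2 (u k)) \<and> L = single_qubit_layer m u)"

text \<open>Tensor product of multi-qubit CZ gates I - 2|1^s><1^s| on the sets of qubits in F
  (identity on the remaining qubits).\<close>
definition cz_layer :: "nat \<Rightarrow> nat set set \<Rightarrow> complex mat" where
  "cz_layer m F = mat (2 ^ m) (2 ^ m)
     (\<lambda>(i, j). if i = j then (\<Prod>S\<in>F. if (\<forall>k\<in>S. qbit i k) then -1 else 1) else 0)"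

definition is_cz_layer :: "nat \<Rightarrow> complex mat \<Rightarrow> bool" where
  "is_cz_layer m M \<longleftrightarrow>
     (\<exists>F. (\<forall>S\<in>F. S \<noteq> {} \<and> S \<subseteq> {..<m}) \<and> (\<forall>S\<in>F. \<forall>T\<in>F. S \<noteq> T \<longrightarrow> S \<inter> T = {})
          \<and> M = cz_layer m F)"

fun qac0_compose :: "(nat \<Rightarrow> complex mat) \<Rightarrow> (nat \<Rightarrow> complex mat) \<Rightarrow> nat \<Rightarrow> complex mat" where
  "qac0_compose L M 0 = L 0"
| "qac0_compose L M (Suc l) = L (Suc l) * M (Suc l) * qac0_compose L M l"

definition qac0_circuit :: "nat \<Rightarrow> nat \<Rightarrow> complex mat \<Rightarrow> bool" where
  "qac0_circuit m d U \<longleftrightarrow>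
     (\<exists>L M. (\<forall>l\<le>d. is_single_qubit_layer m (L l)) \<and> (\<forall>l\<in>{1..d}. is_cz_layer m (M l))
            \<and> U = qac0_compose L M d)"

definition mtrace :: "complex mat \<Rightarrow> complex" where
  "mtrace A = (\<Sum>i<dim_row A. A $$ (i, i))"

definition density_operator :: "nat \<Rightarrow> complex mat \<Rightarrow> bool" where
  "density_operator a \<phi> \<longleftrightarrow> \<phi> \<in> carrier_mat (2 ^ a) (2 ^ a)
     \<and> (\<forall>v\<in>carrier_vec (2 ^ a). 0 \<le> (\<phi> *\<^sub>v v) \<bullet>c v) \<and> mtrace \<phi> = 1"

text \<open>|x><x| (x on the n input qubits 0..n-1, given as the set of coordinates equal to 1)
  tensor \<phi> (on the ancilla qubits n..n+a-1).\<close>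
definition input_state :: "nat \<Rightarrow> nat \<Rightarrow> nat set \<Rightarrow> complex mat \<Rightarrow> complex mat" where
  "input_state n a x \<phi> = mat (2 ^ (n + a)) (2 ^ (n + a))
     (\<lambda>(i, j). if (\<forall>k<n. (qbit i k \<longleftrightarrow> k \<in> x) \<and> (qbit j k \<longleftrightarrow> k \<in> x))
               then \<phi> $$ (i div 2 ^ n, j div 2 ^ n) else 0)"

text \<open>|1><1| on the first (output) qubit tensor identity.\<close>
definition proj_one :: "nat \<Rightarrow> complex mat" where
  "proj_one m = mat (2 ^ m) (2 ^ m) (\<lambda>(i, j). if i = j \<and> qbit i 0 then 1 else 0)"

definition accept_prob :: "nat \<Rightarrow> nat \<Rightarrow> complex mat \<Rightarrow> complex mat \<Rightarrow> nat set \<Rightarrow> real" where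
  "accept_prob n a U \<phi> x =
     Re (mtrace (proj_one (n + a) * (U * input_state n a x \<phi> * mat_adjoint U)))"

text \<open>Points of {0,1}^n are represented by the set of coordinates (in {..<n}) equal to 1.\<close>
definition chi :: "nat set \<Rightarrow> nat set \<Rightarrow> real" where
  "chi S x = (-1) ^ card (S \<inter> x)"

definition fourier_coeff :: "nat \<Rightarrow> (nat set \<Rightarrow> real) \<Rightarrow> nat set \<Rightarrow> real" where
  "fourier_coeff n f S = (\<Sum>x\<in>Pow {..<n}. f x * chi S x) / 2 ^ n"

definition fdeg :: "nat \<Rightarrow> (nat set \<Rightarrow> real) \<Rightarrow> nat" where
  "fdeg n f = Max (insert 0 {card S | S. S \<subseteq> {..<n} \<and> fourier_coeff n f S \<noteq> 0})"

definition approx_deg :: "nat \<Rightarrow> real \<Rightarrow> (nat set \<Rightarrow> real) \<Rightarrow> nat" where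
  "approx_deg n \<epsilon> f =
     (LEAST D. \<exists>g. fdeg n g = D \<and> (\<forall>x\<in>Pow {..<n}. \<bar>f x - g x\<bar> \<le> \<epsilon>))"

end

theory Submission
  imports Defs "HOL-Library.Nat_Bijection"
begin

text \<open>
  Work in the Heisenberg picture, writing \<open>N = n + a\<close>, and call an operator of degree \<open>y\<close> if it is
  a sum of operators each acting on at most \<open>y\<close> qubits. The output projector has degree 1, and an
  operator of degree \<open>y\<close> gives an acceptance probability of Fourier degree at most \<open>y\<close>. Conjugation
  by a layer of single-qubit unitaries preserves the degree. In a CZ layer, fix a threshold \<open>D\<close>.
  Gates on at most \<open>D\<close> qubits multiply the degree by at most \<open>D\<close>. A gate on \<open>s > D\<close> qubits is
  diagonal and is replaced by a Chebyshev polynomial of degree \<open>O(sqrt s log N)\<close> in the Hamming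
  weight; the replaced gates act on disjoint sets, so together they add only \<open>O(N log N / sqrt D)\<close>.
  The choice \<open>D = (K / y)\<^bsup>2/3\<^esup>\<close> with \<open>K = O(N log N)\<close> balances both contributions and turns \<open>y\<close> into
  \<open>2 y\<^bsup>1/3\<^esup> K\<^bsup>2/3\<^esup>\<close>, so after \<open>d\<close> layers the degree is at most \<open>K'\<^bsup>1 - 1/3^d\<^esup>\<close> with \<open>K' = 2\<^bsup>3/2\<^esup> K\<close>.
  The replacement gates are contractions, so the errors of the layers add up; they are measured in
  the seminorm \<open>W \<mapsto> sqrt (Tr (W \<rho> W\<^sup>*))\<close> of the initial state \<open>\<rho>\<close>.
\<close>

subsection \<open>Degree of operators\<close>

text \<open>Bit strings are identified with sets of qubits, and an operator with its matrix entries.\<close>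

definition supported_on :: "nat \<Rightarrow> nat set \<Rightarrow> (nat set \<Rightarrow> nat set \<Rightarrow> complex) \<Rightarrow> bool" where
  "supported_on m S A \<longleftrightarrow> (\<exists>f. \<forall>X\<subseteq>{..<m}. \<forall>Y\<subseteq>{..<m}.
     A X Y = (if X - S = Y - S then f (X \<inter> S) (Y \<inter> S) else 0))"

text \<open>The bound \<open>y\<close> is real because it is later compared with \<open>powr\<close>
  expressions. As an inductive predicate it offers induction over the local summands, so an
  operation linear in \<open>A\<close> needs checking on \<open>supported\<close> operators
  only.\<close>

inductive opdeg :: "nat \<Rightarrow> real \<Rightarrow> (nat set \<Rightarrow> nat set \<Rightarrow> complex) \<Rightarrow> bool" for m y where
  supported: "S \<subseteq> {..<m} \<Longrightarrow> real (card S) \<le> y \<Longrightarrow> supported_on m S A \<Longrightarrow> opdeg m y A"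
| add: "opdeg m y A \<Longrightarrow> opdeg m y B \<Longrightarrow> opdeg m y (\<lambda>X Y. A X Y + B X Y)"

lemma supported_onI:
  assumes "\<And>X Y. X \<subseteq> {..<m} \<Longrightarrow> Y \<subseteq> {..<m} \<Longrightarrow>
    A X Y = (if X - S = Y - S then f (X \<inter> S) (Y \<inter> S) else 0)"
  shows "supported_on m S A"
  using assms unfolding supported_on_def by blast

lemma opdeg_mono:
  assumes "opdeg m y A" "y \<le> y'"
  shows "opdeg m y' A"
  using assms
proof induction
  case (supported S A)
  then show ?case by (intro opdeg.supported[of S]) simp_all
qed (blast intro: opdeg.add)

lemma supported_on_all: "supported_on m {..<m} A"
proof (rule supported_onI)
  fix X Y :: "nat set"
  assume XY: "X \<subseteq> {..<m}" "Y \<subseteq> {..<m}"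
  then have "X - {..<m} = Y - {..<m}" "X \<inter> {..<m} = X" "Y \<inter> {..<m} = Y"
    by blast+
  then show "A X Y = (if X - {..<m} = Y - {..<m} then A (X \<inter> {..<m}) (Y \<inter> {..<m}) else 0)"
    by simp
qed

text \<open>Settles the situation where a degree bound is too large to say anything.\<close>

lemma opdeg_full: "real m \<le> y \<Longrightarrow> opdeg m y A"
  by (rule opdeg.supported[of "{..<m}"]) (simp_all add: supported_on_all)

text \<open>Diagonal factors are applied below on the row index only; transposing before and after
  carries them over to the column index.\<close>

lemma opdeg_transpose:
  assumes "opdeg m y A"
  shows "opdeg m y (\<lambda>X Y. A Y X)"
  using assms
proof induction
  case (supported S A)
  from supported(3) obtain f where f: "\<And>X Y. X \<subseteq> {..<m} \<Longrightarrow> Y \<subseteq> {..<m} \<Longrightarrow>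
     A X Y = (if X - S = Y - S then f (X \<inter> S) (Y \<inter> S) else 0)"
    unfolding supported_on_def by metis
  have "supported_on m S (\<lambda>X Y. A Y X)"
  proof (rule supported_onI[where f = "\<lambda>X Y. f Y X"])
    fix X Y :: "nat set"
    assume "X \<subseteq> {..<m}" "Y \<subseteq> {..<m}"
    note fYX = f[OF this(2,1)]
    show "A Y X = (if X - S = Y - S then f (Y \<inter> S) (X \<inter> S) else 0)"
      unfolding fYX by (rule if_cong) auto
  qed
  then show ?case using supported by (intro opdeg.supported[of S]) simp_all
next
  case (add A B)
  from opdeg.add[OF add.IH] show ?case .
qed

text \<open>Entries of \<open>A\<close> with \<open>X - S \<noteq> Y - S\<close> vanish, so the
  factor \<open>h\<close> has to be local only on pairs that agree outside \<open>S\<close>. This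
  weaker demand lets CZ gates that miss \<open>S\<close> cancel although neither of their two signs
  is local.\<close>

lemma supported_on_mult_local:
  assumes "supported_on m S A" and h: "\<And>X Y. X \<subseteq> {..<m} \<Longrightarrow> Y \<subseteq> {..<m} \<Longrightarrow> X - S = Y - S \<Longrightarrow>
     h X Y = h (X \<inter> (S \<union> R)) (Y \<inter> (S \<union> R))"
  shows "supported_on m (S \<union> R) (\<lambda>X Y. h X Y * A X Y)"
proof -
  from assms(1) obtain f where f: "\<And>X Y. X \<subseteq> {..<m} \<Longrightarrow> Y \<subseteq> {..<m} \<Longrightarrow>
     A X Y = (if X - S = Y - S then f (X \<inter> S) (Y \<inter> S) else 0)"
    unfolding supported_on_def by metis
  show ?thesis
  proof (rule supported_onI)
    fix X Y :: "nat set"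
    assume XY: "X \<subseteq> {..<m}" "Y \<subseteq> {..<m}"
    let ?X = "X \<inter> (S \<union> R)" and ?Y = "Y \<inter> (S \<union> R)"
    have 2: "?X \<inter> S = X \<inter> S" "?Y \<inter> S = Y \<inter> S" by auto
    \<comment> \<open>The kernel on \<open>S \<union> R\<close> keeps the test outside
      \<open>S\<close>, because \<open>A\<close> is the identity on \<open>R - S\<close>.\<close>
    show "h X Y * A X Y = (if X - (S \<union> R) = Y - (S \<union> R) then
        (\<lambda>X Y. if X - S = Y - S then h X Y * f (X \<inter> S) (Y \<inter> S) else 0) ?X ?Y else 0)"
    proof (cases "X - S = Y - S")
      case True
      then have "X - (S \<union> R) = Y - (S \<union> R)" "?X - S = ?Y - S" by blast+
      then show ?thesis
        by (simp only: f[OF XY] True h[OF XY True] 2 if_True simp_thms)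
    next
      case False
      then have "\<not> (X - (S \<union> R) = Y - (S \<union> R) \<and> ?X - S = ?Y - S)" by blast
      moreover have "h X Y * A X Y = 0"
        using False by (simp only: f[OF XY] if_False mult_zero_right)
      ultimately show ?thesis by presburger
    qed
  qed
qed

lemma opdeg_scale:
  assumes "opdeg m y A"
  shows "opdeg m y (\<lambda>X Y. c * A X Y)"
  using assms
proof induction
  case (supported S A)
  have "supported_on m (S \<union> {}) (\<lambda>X Y. c * A X Y)"
    by (rule supported_on_mult_local[OF supported(3)]) simp
  then show ?case using supported by (intro opdeg.supported[of S]) simp_all
next
  case (add A B)
  from opdeg.add[OF add.IH] show ?case by (simp add: distrib_left)
qed

text \<open>The degree of a diagonal operator is defined through its action by multiplication, which makes
  the closure properties immediate.\<close>

definition mult_deg :: "nat \<Rightarrow> real \<Rightarrow> (nat set \<Rightarrow> real) \<Rightarrow> bool" where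
  "mult_deg m t h \<longleftrightarrow>
     (\<forall>y A. opdeg m y A \<longrightarrow> opdeg m (y + t) (\<lambda>X Y. complex_of_real (h X) * A X Y))"

lemma mult_deg_const: "0 \<le> t \<Longrightarrow> mult_deg m t (\<lambda>_. c)"
  unfolding mult_deg_def by (intro allI impI, rule opdeg_scale, erule opdeg_mono) simp

lemma mult_deg_indicator:
  assumes "k < m"
  shows "mult_deg m 1 (\<lambda>X. of_bool (k \<in> X))"
  unfolding mult_deg_def
proof (intro allI impI)
  fix y A assume "opdeg m y A"
  then show "opdeg m (y + 1) (\<lambda>X Y. complex_of_real (of_bool (k \<in> X)) * A X Y)"
  proof induction
    case (supported S A)
    have "supported_on m (S \<union> {k}) (\<lambda>X Y. complex_of_real (of_bool (k \<in> X)) * A X Y)"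
      by (rule supported_on_mult_local[OF supported(3)]) simp
    moreover have "real (card (S \<union> {k})) \<le> y + 1"
      using supported(2) card_Un_le[of S "{k}"] by simp
    ultimately show ?case
      using supported assms by (intro opdeg.supported[of "S \<union> {k}"]) auto
  next
    case (add A B)
    from opdeg.add[OF add.IH] show ?case by (simp add: distrib_left)
  qed
qed

lemma mult_deg_add:
  assumes "mult_deg m t h" "mult_deg m t g"
  shows "mult_deg m t (\<lambda>X. h X + g X)"
  unfolding mult_deg_def
proof (intro allI impI)
  fix y A assume "opdeg m y A"
  then have "opdeg m (y + t) (\<lambda>X Y. complex_of_real (h X) * A X Y + complex_of_real (g X) * A X Y)"
    using assms by (intro opdeg.add) (simp_all add: mult_deg_def)
  then show "opdeg m (y + t) (\<lambda>X Y. complex_of_real (h X + g X) * A X Y)"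
    by (simp add: distrib_right)
qed

lemma mult_deg_mult:
  assumes "mult_deg m s h" "mult_deg m t g"
  shows "mult_deg m (s + t) (\<lambda>X. h X * g X)"
  unfolding mult_deg_def
proof (intro allI impI)
  fix y A assume "opdeg m y A"
  then have "opdeg m (y + t) (\<lambda>X Y. complex_of_real (g X) * A X Y)"
    using assms(2) by (simp add: mult_deg_def)
  then have "opdeg m (y + t + s) (\<lambda>X Y. complex_of_real (h X) * (complex_of_real (g X) * A X Y))"
    using assms(1) unfolding mult_deg_def by blast
  then show "opdeg m (y + (s + t)) (\<lambda>X Y. complex_of_real (h X * g X) * A X Y)"
    by (simp add: ac_simps)
qed

lemma mult_deg_cmult: "mult_deg m t h \<Longrightarrow> mult_deg m t (\<lambda>X. c * h X)"
  using mult_deg_mult[OF mult_deg_const[of 0 m c]] by simp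

lemma mult_deg_mono: "mult_deg m s h \<Longrightarrow> s \<le> t \<Longrightarrow> mult_deg m t h"
  unfolding mult_deg_def by (meson add_left_mono opdeg_mono)

lemma mult_deg_sum:
  assumes "finite I" "0 \<le> t" "\<And>i. i \<in> I \<Longrightarrow> mult_deg m t (h i)"
  shows "mult_deg m t (\<lambda>X. \<Sum>i\<in>I. h i X)"
  using assms(1,3)
proof (induction I)
  case empty
  then show ?case using mult_deg_const[OF assms(2)] by simp
next
  case (insert i I)
  then have "mult_deg m t (\<lambda>X. h i X + (\<Sum>i\<in>I. h i X))"
    by (intro mult_deg_add) simp_all
  with insert.hyps show ?case by simp
qed

lemma mult_deg_prod:
  assumes "finite I" "\<And>i. i \<in> I \<Longrightarrow> mult_deg m (t i) (h i)"
  shows "mult_deg m (\<Sum>i\<in>I. t i) (\<lambda>X. \<Prod>i\<in>I. h i X)"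
  using assms
proof (induction I)
  case empty
  then show ?case using mult_deg_const[of 0] by simp
next
  case (insert i I)
  then have "mult_deg m (t i + (\<Sum>i\<in>I. t i)) (\<lambda>X. h i X * (\<Prod>i\<in>I. h i X))"
    by (intro mult_deg_mult) simp_all
  with insert.hyps show ?case by simp
qed

lemma mult_deg_power:
  assumes "mult_deg m t h"
  shows "mult_deg m (real l * t) (\<lambda>X. h X ^ l)"
  using mult_deg_prod[of "{..<l}" m "\<lambda>_. t" "\<lambda>_. h"] assms by simp

text \<open>The column factor becomes a row factor after transposition, so each of the two sides
  costs \<open>t\<close>.\<close>

lemma opdeg_conj_diag:
  assumes "mult_deg m t h" "opdeg m y A"
  shows "opdeg m (y + 2 * t) (\<lambda>X Y. complex_of_real (h X) * A X Y * complex_of_real (h Y))"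
proof -
  have "opdeg m (y + t) (\<lambda>X Y. complex_of_real (h Y) * A X Y)"
    using opdeg_transpose[of m "y + t" "\<lambda>X Y. complex_of_real (h X) * A Y X"]
      opdeg_transpose[OF assms(2)] assms(1) by (simp add: mult_deg_def)
  then have "opdeg m (y + t + t) (\<lambda>X Y. complex_of_real (h X) * (complex_of_real (h Y) * A X Y))"
    using assms(1) unfolding mult_deg_def by blast
  then show ?thesis by (simp add: ac_simps)
qed

subsection \<open>Chebyshev approximation of a multi-qubit CZ gate\<close>

fun cheb :: "nat \<Rightarrow> real \<Rightarrow> real" where
  "cheb 0 x = 1"
| "cheb (Suc 0) x = x"
| "cheb (Suc (Suc k)) x = 2 * x * cheb (Suc k) x - cheb k x"

lemma cheb_cos: "cheb k (cos t) = cos (real k * t)"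
proof (induction k "cos t" rule: cheb.induct)
  case (3 k)
  have "cos ((real k + 1) * t + t) + cos ((real k + 1) * t - t) = 2 * cos ((real k + 1) * t) * cos t"
    by (simp only: cos_add cos_diff)
  moreover have "(real k + 1) * t + t = real (Suc (Suc k)) * t" "(real k + 1) * t - t = real k * t"
    by (simp_all add: algebra_simps)
  ultimately show ?case using 3 by (simp add: algebra_simps)
qed simp_all

lemma abs_cheb_le_1: "\<bar>x\<bar> \<le> 1 \<Longrightarrow> \<bar>cheb k x\<bar> \<le> 1"
  using cheb_cos[of k "arccos x"] by (simp add: cos_arccos_abs)

text \<open>\<open>(real k)\<^sup>2\<close> is the derivative of the \<open>k\<close>-th Chebyshev
  polynomial at 1. Beyond 1 the polynomial grows at least at that rate, which is the source of the
  square root in the degree.\<close>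

lemma cheb_growth:
  assumes "0 \<le> \<mu>"
  shows "cheb k (1 + \<mu>) \<ge> 1 + (real k)\<^sup>2 * \<mu>"
proof -
  \<comment> \<open>By the recurrence the difference of consecutive values increases by
    \<open>2 * \<mu> * cheb (Suc k) (1 + \<mu>)\<close>, which is at least \<open>2 * \<mu>\<close>;
    the odd numbers then sum to the square.\<close>
  have "cheb k (1 + \<mu>) \<ge> 1 + (real k)\<^sup>2 * \<mu> \<and>
    cheb (Suc k) (1 + \<mu>) - cheb k (1 + \<mu>) \<ge> (2 * real k + 1) * \<mu>"
  proof (induction k)
    case (Suc k)
    have 1: "cheb (Suc k) (1 + \<mu>) \<ge> 1 + (real (Suc k))\<^sup>2 * \<mu>"
      using Suc by (simp add: power2_eq_square algebra_simps)
    have "0 \<le> (real (Suc k))\<^sup>2 * \<mu>" using assms by simp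
    with 1 have "cheb (Suc k) (1 + \<mu>) \<ge> 1" by linarith
    then have "\<mu> * cheb (Suc k) (1 + \<mu>) \<ge> \<mu> * 1" using assms by (intro mult_left_mono)
    with Suc 1 show ?case by (simp add: algebra_simps)
  qed simp
  then show ?thesis ..
qed

lemma mult_deg_cheb:
  assumes "mult_deg m 1 w"
  shows "mult_deg m (real k) (\<lambda>X. cheb k (w X))"
proof -
  \<comment> \<open>Two consecutive indices, as the recurrence looks back two steps.\<close>
  have "mult_deg m (real k) (\<lambda>X. cheb k (w X)) \<and> mult_deg m (real (Suc k)) (\<lambda>X. cheb (Suc k) (w X))"
  proof (induction k)
    case 0
    then show ?case using assms mult_deg_const[of 0] by simp
  next
    case (Suc k)
    have "mult_deg m (1 + real (Suc k)) (\<lambda>X. 2 * (w X * cheb (Suc k) (w X)))"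
      by (intro mult_deg_cmult mult_deg_mult assms) (use Suc in blast)
    moreover have "mult_deg m (1 + real (Suc k)) (\<lambda>X. (- 1) * cheb k (w X))"
      by (rule mult_deg_cmult, rule mult_deg_mono[of _ "real k"]) (use Suc in auto)
    ultimately have "mult_deg m (1 + real (Suc k)) (\<lambda>X. 2 * (w X * cheb (Suc k) (w X)) + (- 1) * cheb k (w X))"
      by (rule mult_deg_add)
    with Suc show ?case by (simp add: algebra_simps)
  qed
  then show ?thesis ..
qed

text \<open>The diagonal entry at basis state \<open>X\<close> of the CZ gate on the qubits
  \<open>T\<close>.\<close>

definition cz_sign :: "nat set \<Rightarrow> nat set \<Rightarrow> real" where
  "cz_sign T X = (if T \<subseteq> X then - 1 else 1)"

text \<open>On rescaled Hamming weights below \<open>card T\<close> the Chebyshev polynomial is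
  bounded by 1, while at full weight it is at least 2. Normalising it there to 1 and taking an even
  power gives \<open>b\<close>, which is exactly 1 if \<open>T \<subseteq> X\<close> and tiny
  otherwise; \<open>1 - 2 * b\<close> then mimics the sign and stays in
  \<open>[-1, 1]\<close>.\<close>

lemma cz_sign_approx:
  fixes T :: "nat set"
  assumes T: "T \<subseteq> {..<m}" "card T \<ge> 2"
  obtains h where "mult_deg m (4 * real l * sqrt (card T)) h"
    and "\<And>X. \<bar>h X\<bar> \<le> 1" and "\<And>X. \<bar>h X - cz_sign T X\<bar> \<le> 2 / 4 ^ l"
proof -
  define s where "s = card T"
  \<comment> \<open>This scaling sends the weights 0 to \<open>s - 1\<close> into
    \<open>[0, 1]\<close> and the weight \<open>s\<close> to \<open>1 + \<mu>\<close>.\<close>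
  define \<mu> where "\<mu> = 1 / (real s - 1)"
  \<comment> \<open>About \<open>sqrt s\<close> is enough:
    \<open>k\<^sup>2 * \<mu> \<ge> s / (s - 1) \<ge> 1\<close> brings the value at
    \<open>1 + \<mu>\<close> up to 2.\<close>
  define k where "k = nat \<lceil>sqrt s\<rceil>"
  define w :: "nat set \<Rightarrow> real" where "w X = \<mu> * (\<Sum>i\<in>T. of_bool (i \<in> X))" for X
  \<comment> \<open>The even exponent keeps \<open>b\<close> nonnegative; off the full weight the
    base has modulus at most 1/2, which gives \<open>1 / 4 ^ l\<close>.\<close>
  define b where "b X = (1 / cheb k (1 + \<mu>) * cheb k (w X)) ^ (2 * l)" for X
  have fin: "finite T" using T(1) finite_subset by blast
  have s: "s \<ge> 2" "real s \<ge> 2" using T s_def by auto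
  have \<mu>: "\<mu> > 0" using s by (simp add: \<mu>_def)
  have wX: "w X = \<mu> * card (T \<inter> X)" for X
    using fin by (simp add: w_def sum.If_cases of_bool_def)
  have k: "sqrt s \<le> k" "real k \<le> 2 * sqrt s"
  proof -
    have "sqrt s \<ge> 1" using s by simp
    then show "sqrt s \<le> k" "real k \<le> 2 * sqrt s" unfolding k_def by linarith+
  qed
  have c2: "cheb k (1 + \<mu>) \<ge> 2"
  proof -
    have "real s \<le> (real k)\<^sup>2" using k(1) by (rule sqrt_le_D)
    moreover have "real s * \<mu> \<ge> 1" using s by (simp add: \<mu>_def field_simps)
    ultimately have "1 \<le> (real k)\<^sup>2 * \<mu>" using \<mu> by (smt (verit) mult_right_mono)
    then show ?thesis using cheb_growth[of \<mu> k] \<mu> by linarith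
  qed
  have mdw: "mult_deg m 1 w"
    unfolding w_def using T(1) fin
    by (intro mult_deg_cmult mult_deg_sum mult_deg_indicator) auto
  have "mult_deg m (real (2 * l) * real k) b"
    unfolding b_def by (intro mult_deg_power mult_deg_cmult mult_deg_cheb mdw)
  then have "mult_deg m (4 * real l * sqrt s) b"
  proof (rule mult_deg_mono)
    have "real (2 * l) * real k \<le> real (2 * l) * (2 * sqrt s)"
      using k by (intro mult_left_mono) auto
    then show "real (2 * l) * real k \<le> 4 * real l * sqrt s" by simp
  qed
  then have deg: "mult_deg m (4 * real l * sqrt s) (\<lambda>X. 1 + (- 2) * b X)"
    by (intro mult_deg_add mult_deg_cmult mult_deg_const) auto
  have b0: "0 \<le> b X" for X unfolding b_def by (simp add: power_mult)
  have b1: "b X = 1" if "T \<subseteq> X" for X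
  proof -
    have "w X = 1 + \<mu>" using that s by (simp add: wX Int_absorb2 s_def[symmetric] \<mu>_def field_simps)
    then show ?thesis using c2 by (simp add: b_def)
  qed
  have bs: "b X \<le> 1 / 4 ^ l" if "\<not> T \<subseteq> X" for X
  proof -
    have "card (T \<inter> X) < s" unfolding s_def using that fin by (intro psubset_card_mono) auto
    then have "real (card (T \<inter> X)) \<le> real s - 1" by linarith
    then have "\<bar>w X\<bar> \<le> 1" using s by (simp add: wX \<mu>_def field_simps)
    then have "\<bar>1 / cheb k (1 + \<mu>) * cheb k (w X)\<bar> \<le> (1 / 2) * 1"
      unfolding abs_mult using c2 abs_cheb_le_1 by (intro mult_mono) (auto simp: field_simps)
    then have "\<bar>1 / cheb k (1 + \<mu>) * cheb k (w X)\<bar> ^ (2 * l) \<le> (1 / 2) ^ (2 * l)"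
      by (intro power_mono) auto
    then have "b X \<le> (1 / 2) ^ (2 * l)" unfolding b_def by (subst (asm) power_even_abs) simp_all
    then show ?thesis by (simp add: power_mult power_divide)
  qed
  have "b X \<le> 1" for X
  proof (cases "T \<subseteq> X")
    case False
    have "1 / 4 ^ l \<le> (1 :: real)" by simp
    with bs[OF False] show ?thesis by linarith
  qed (simp add: b1)
  then have "\<bar>1 + (- 2) * b X\<bar> \<le> 1" for X
    using b0[of X] by (simp add: abs_le_iff)
  moreover have "\<bar>1 + (- 2) * b X - cz_sign T X\<bar> \<le> 2 / 4 ^ l" for X
  proof (cases "T \<subseteq> X")
    case True
    then show ?thesis by (simp add: cz_sign_def b1)
  next
    case False
    then have "cz_sign T X = 1" by (simp add: cz_sign_def)
    moreover have "2 * b X \<le> 2 / 4 ^ l" using bs[OF False] by simp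
    ultimately show ?thesis using b0[of X] by linarith
  qed
  ultimately show ?thesis using deg that unfolding s_def by blast
qed

subsection \<open>Conjugation by circuit layers\<close>

definition tensor_on :: "nat set \<Rightarrow> (nat \<Rightarrow> bool \<Rightarrow> bool \<Rightarrow> complex) \<Rightarrow> nat set \<Rightarrow> nat set \<Rightarrow> complex" where
  "tensor_on T u X Y = (\<Prod>k\<in>T. u k (k \<in> X) (k \<in> Y))"

definition col_orthonormal :: "(bool \<Rightarrow> bool \<Rightarrow> complex) \<Rightarrow> bool" where
  "col_orthonormal v \<longleftrightarrow> (\<forall>c c'. v True c * cnj (v True c') + v False c * cnj (v False c') = of_bool (c = c'))"

lemma sum_Pow_prod:
  fixes g :: "'a \<Rightarrow> bool \<Rightarrow> 'b :: comm_semiring_1"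
  assumes "finite T"
  shows "(\<Sum>Z\<in>Pow T. \<Prod>k\<in>T. g k (k \<in> Z)) = (\<Prod>k\<in>T. g k True + g k False)"
  unfolding prod_add[OF assms]
proof (rule sum.cong)
  fix Z assume "Z \<in> Pow T"
  then have "Z \<subseteq> T" by simp
  from prod.subset_diff[OF this assms, of "\<lambda>k. g k (k \<in> Z)"]
  show "(\<Prod>k\<in>T. g k (k \<in> Z)) = (\<Prod>k\<in>Z. g k True) * (\<Prod>k\<in>T - Z. g k False)"
    by (simp add: mult.commute)
qed simp

text \<open>The sum over basis states factorises into one sum per qubit, each an inner product of
  two columns of \<open>u k\<close>.\<close>

lemma tensor_on_orthonormal:
  assumes "finite T" "\<And>k. k \<in> T \<Longrightarrow> col_orthonormal (u k)"
  shows "(\<Sum>Z\<in>Pow T. tensor_on T u Z X * cnj (tensor_on T u Z Y)) = of_bool (X \<inter> T = Y \<inter> T)"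
proof -
  have "(\<Sum>Z\<in>Pow T. tensor_on T u Z X * cnj (tensor_on T u Z Y)) =
    (\<Sum>Z\<in>Pow T. \<Prod>k\<in>T. u k (k \<in> Z) (k \<in> X) * cnj (u k (k \<in> Z) (k \<in> Y)))"
    by (simp add: tensor_on_def prod.distrib cnj_prod)
  also have "\<dots> = (\<Prod>k\<in>T. u k True (k \<in> X) * cnj (u k True (k \<in> Y)) + u k False (k \<in> X) * cnj (u k False (k \<in> Y)))"
    by (rule sum_Pow_prod[OF assms(1), of "\<lambda>k b. u k b (k \<in> X) * cnj (u k b (k \<in> Y))"])
  also have "\<dots> = (\<Prod>k\<in>T. of_bool ((k \<in> X) = (k \<in> Y)))"
    using assms(2) by (intro prod.cong) (auto simp: col_orthonormal_def)
  also have "\<dots> = of_bool (\<forall>k\<in>T. (k \<in> X) = (k \<in> Y))"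
    using assms(1) by (induction T) auto
  also have "(\<forall>k\<in>T. (k \<in> X) = (k \<in> Y)) \<longleftrightarrow> X \<inter> T = Y \<inter> T" by blast
  finally show ?thesis .
qed

lemma sum_Pow_split:
  assumes "S \<subseteq> M"
  shows "(\<Sum>Z\<in>Pow M. f Z) = (\<Sum>A\<in>Pow S. \<Sum>B\<in>Pow (M - S). f (A \<union> B))"
proof -
  have "(\<Sum>A\<in>Pow S. \<Sum>B\<in>Pow (M - S). f (A \<union> B)) = (\<Sum>(A, B)\<in>Pow S \<times> Pow (M - S). f (A \<union> B))"
    by (simp add: sum.cartesian_product)
  also have "\<dots> = (\<Sum>Z\<in>Pow M. f Z)"
    by (rule sum.reindex_bij_witness[of _ "\<lambda>Z. (Z \<inter> S, Z - S)" "\<lambda>(A, B). A \<union> B"])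
      (use assms in auto)
  finally show ?thesis by simp
qed

text \<open>Up to transposition of indices this is conjugation in the Heisenberg picture.\<close>

definition heis :: "nat \<Rightarrow> (nat set \<Rightarrow> nat set \<Rightarrow> complex) \<Rightarrow> (nat set \<Rightarrow> nat set \<Rightarrow> complex) \<Rightarrow>
    nat set \<Rightarrow> nat set \<Rightarrow> complex" where
  "heis m U A Y Z = (\<Sum>X\<in>Pow {..<m}. \<Sum>X'\<in>Pow {..<m}. U X Y * A X X' * cnj (U X' Z))"

text \<open>Basis states split into a part in \<open>S\<close> and the rest. Outside
  \<open>S\<close> the operator is the identity, so the factors there contract to inner products of
  columns and give back the identity; the factors in \<open>S\<close> only change the
  kernel.\<close>

lemma supported_on_heis_tensor:
  assumes S: "S \<subseteq> {..<m}" and sup: "supported_on m S A"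
    and u: "\<And>k. k < m \<Longrightarrow> col_orthonormal (u k)"
  shows "supported_on m S (heis m (tensor_on {..<m} u) A)"
proof -
  let ?M = "{..<m}"
  from sup obtain f where f: "\<And>X Y. X \<subseteq> ?M \<Longrightarrow> Y \<subseteq> ?M \<Longrightarrow>
     A X Y = (if X - S = Y - S then f (X \<inter> S) (Y \<inter> S) else 0)"
    unfolding supported_on_def by metis
  define tS where "tS = tensor_on S u"
  define tC where "tC = tensor_on (?M - S) u"
  have fin: "finite S" using S finite_subset by blast
  have split: "tensor_on ?M u (P \<union> B) Y = tC B Y * tS P Y" if "P \<subseteq> S" "B \<subseteq> ?M - S" for P B Y
  proof -
    have "tensor_on ?M u (P \<union> B) Y = tensor_on (?M - S) u (P \<union> B) Y * tensor_on S u (P \<union> B) Y"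
      unfolding tensor_on_def by (rule prod.subset_diff[OF S]) simp
    also have "tensor_on (?M - S) u (P \<union> B) Y = tC B Y"
      unfolding tensor_on_def tC_def using that
      by (intro prod.cong refl arg_cong2[where f = "u _"]) auto
    also have "tensor_on S u (P \<union> B) Y = tS P Y"
      unfolding tensor_on_def tS_def using that
      by (intro prod.cong refl arg_cong2[where f = "u _"]) auto
    finally show ?thesis .
  qed
  have Aval: "A (P \<union> B) (P' \<union> B') = (if B = B' then f P P' else 0)"
    if "P \<subseteq> S" "B \<subseteq> ?M - S" "P' \<subseteq> S" "B' \<subseteq> ?M - S" for P B P' B'
  proof -
    have eqs: "P \<union> B - S = B" "P' \<union> B' - S = B'" "(P \<union> B) \<inter> S = P" "(P' \<union> B') \<inter> S = P'"
      using that by blast+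
    have "P \<union> B \<subseteq> ?M" "P' \<union> B' \<subseteq> ?M" using that S by blast+
    from f[OF this] show ?thesis by (simp only: eqs)
  qed
  \<comment> \<open>The new kernel: \<open>f\<close> conjugated by the factors on \<open>S\<close>
    alone.\<close>
  define g where "g P Q = (\<Sum>A\<in>Pow S. \<Sum>A'\<in>Pow S. tS A P * f A A' * cnj (tS A' Q))" for P Q
  have tS: "tS P Y = tS P (Y \<inter> S)" for P Y
    unfolding tS_def tensor_on_def by (intro prod.cong) auto
  have "heis m (tensor_on ?M u) A Y Z = (if Y - S = Z - S then g (Y \<inter> S) (Z \<inter> S) else 0)"
    if YZ: "Y \<subseteq> ?M" "Z \<subseteq> ?M" for Y Z
  proof -
    have "heis m (tensor_on ?M u) A Y Z =
      (\<Sum>P\<in>Pow S. \<Sum>B\<in>Pow (?M - S). \<Sum>P'\<in>Pow S. \<Sum>B'\<in>Pow (?M - S).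
         (tC B Y * tS P Y) * (if B = B' then f P P' else 0) * cnj (tC B' Z * tS P' Z))"
      unfolding heis_def sum_Pow_split[OF S]
      by (intro sum.cong refl) (simp only: split Aval Pow_iff)
    also have "\<dots> = (\<Sum>P\<in>Pow S. \<Sum>B\<in>Pow (?M - S). \<Sum>P'\<in>Pow S.
         (tC B Y * tS P Y) * f P P' * cnj (tC B Z * tS P' Z))"
    proof (intro sum.cong refl)
      fix P B P' assume "B \<in> Pow (?M - S)"
      moreover have "(tC B Y * tS P Y) * (if B = B' then f P P' else 0) * cnj (tC B' Z * tS P' Z)
         = (if B = B' then (tC B Y * tS P Y) * f P P' * cnj (tC B' Z * tS P' Z) else 0)" for B'
        by simp
      ultimately show "(\<Sum>B'\<in>Pow (?M - S).
         (tC B Y * tS P Y) * (if B = B' then f P P' else 0) * cnj (tC B' Z * tS P' Z))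
         = (tC B Y * tS P Y) * f P P' * cnj (tC B Z * tS P' Z)"
        by (simp only: sum.delta' finite_Pow_iff finite_Diff finite_lessThan if_True)
    qed
    also have "\<dots> = g Y Z * (\<Sum>B\<in>Pow (?M - S). tC B Y * cnj (tC B Z))"
      unfolding g_def sum_distrib_right sum_distrib_left
      by (subst sum.swap, intro sum.cong refl) (simp add: ac_simps)
    also have "g Y Z = g (Y \<inter> S) (Z \<inter> S)"
      unfolding g_def by (simp only: tS[of _ Y] tS[of _ Z])
    also have "(\<Sum>B\<in>Pow (?M - S). tC B Y * cnj (tC B Z)) = of_bool (Y \<inter> (?M - S) = Z \<inter> (?M - S))"
      unfolding tC_def by (rule tensor_on_orthonormal) (auto intro: u)
    also have "Y \<inter> (?M - S) = Z \<inter> (?M - S) \<longleftrightarrow> Y - S = Z - S" using YZ by blast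
    finally show ?thesis by simp
  qed
  then show ?thesis by (rule supported_onI)
qed

lemma heis_add: "heis m U (\<lambda>X Y. A X Y + B X Y) Y Z = heis m U A Y Z + heis m U B Y Z"
  by (simp add: heis_def distrib_left distrib_right sum.distrib)

lemma opdeg_heis_tensor:
  assumes "opdeg m y A" "\<And>k. k < m \<Longrightarrow> col_orthonormal (u k)"
  shows "opdeg m y (heis m (tensor_on {..<m} u) A)"
  using assms(1)
proof induction
  case (supported S A)
  then show ?case
    using supported_on_heis_tensor[OF supported(1,3) assms(2)] by (intro opdeg.supported[of S]) simp_all
next
  case (add A B)
  from opdeg.add[OF add.IH] show ?case by (simp add: heis_add[abs_def])
qed

section \<open>Replacement of a CZ layer\<close>

text \<open>A light-cone argument. A gate that misses \<open>S\<close> meets the same bits in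
  \<open>X\<close> and \<open>Y\<close>, so its two signs multiply to 1; only gates meeting
  \<open>S\<close> enlarge the support. As gates are disjoint, each qubit of \<open>S\<close> pulls
  in at most one of them, hence at most \<open>D\<close> qubits.\<close>

lemma opdeg_conj_small_cz:
  assumes F: "\<And>T. T \<in> F \<Longrightarrow> T \<subseteq> {..<m} \<and> real (card T) \<le> D"
    and disj: "\<And>T T'. T \<in> F \<Longrightarrow> T' \<in> F \<Longrightarrow> T \<noteq> T' \<Longrightarrow> T \<inter> T' = {}"
    and D: "1 \<le> D" and A: "opdeg m y A"
  shows "opdeg m (y * D) (\<lambda>X Y. complex_of_real (\<Prod>T\<in>F. cz_sign T X) * A X Y *
           complex_of_real (\<Prod>T\<in>F. cz_sign T Y))"
  using A
proof induction
  case (supported S A)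
  define R where "R = \<Union>{T \<in> F. T \<inter> S \<noteq> {}}"
  \<comment> \<open>Both signs form one factor, since only their product is local.\<close>
  define c where "c X Y = (\<Prod>T\<in>F. cz_sign T X * cz_sign T Y)" for X Y
  have finS: "finite S" using supported(1) finite_subset by blast
  have "c X Y = c (X \<inter> (S \<union> R)) (Y \<inter> (S \<union> R))" if XY: "X - S = Y - S" for X Y
    unfolding c_def
  proof (rule prod.cong[OF refl])
    fix T assume T: "T \<in> F"
    let ?X = "X \<inter> (S \<union> R)" and ?Y = "Y \<inter> (S \<union> R)"
    show "cz_sign T X * cz_sign T Y = cz_sign T ?X * cz_sign T ?Y"
    proof (cases "T \<inter> S = {}")
      case True
      then have "T \<subseteq> X \<longleftrightarrow> T \<subseteq> Y" "T \<subseteq> ?X \<longleftrightarrow> T \<subseteq> ?Y" using XY by blast+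
      then show ?thesis by (simp add: cz_sign_def)
    next
      case False
      then have "T \<subseteq> S \<union> R" using T unfolding R_def by blast
      then show ?thesis by (simp add: cz_sign_def)
    qed
  qed
  then have "supported_on m (S \<union> R) (\<lambda>X Y. complex_of_real (c X Y) * A X Y)"
    by (intro supported_on_mult_local[OF supported(3)]) metis
  moreover have "S \<union> R \<subseteq> {..<m}" using supported(1) F unfolding R_def by blast
  moreover have "real (card (S \<union> R)) \<le> y * D"
  proof -
    \<comment> \<open>\<open>G s\<close> is the gate through \<open>s\<close>, or just
      \<open>{s}\<close> if no gate acts there; the second case is where \<open>1 \<le> D\<close>
      enters.\<close>
    define G where "G s = insert s (\<Union>{T \<in> F. s \<in> T})" for s
    have G: "real (card (G s)) \<le> D" if "s \<in> S" for s
    proof (cases "\<exists>T\<in>F. s \<in> T")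
      case True
      then obtain T where T: "T \<in> F" "s \<in> T" by blast
      then have "{T \<in> F. s \<in> T} = {T}" using disj by blast
      then have "G s = T" using T by (auto simp: G_def)
      then show ?thesis using F T by simp
    next
      case False
      then have "{T \<in> F. s \<in> T} = {}" by blast
      then have "G s = {s}" by (simp only: G_def Union_empty)
      then show ?thesis using D by simp
    qed
    have "S \<union> R = (\<Union>s\<in>S. G s)" unfolding R_def G_def by blast
    then have "real (card (S \<union> R)) \<le> real (\<Sum>s\<in>S. card (G s))"
      using card_UN_le[OF finS, of G] by (simp only: of_nat_le_iff)
    also have "\<dots> \<le> (\<Sum>s\<in>S. D)" unfolding of_nat_sum by (intro sum_mono G)
    also have "\<dots> = real (card S) * D" by simp
    also have "\<dots> \<le> y * D" using supported(2) D by (intro mult_right_mono) auto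
    finally show ?thesis .
  qed
  ultimately have "opdeg m (y * D) (\<lambda>X Y. complex_of_real (c X Y) * A X Y)"
    by (intro opdeg.supported[of "S \<union> R"])
  then show ?case by (simp add: c_def prod.distrib ac_simps)
next
  case (add A B)
  from opdeg.add[OF add.IH] show ?case by (simp add: distrib_left distrib_right)
qed

text \<open>The factor 8 in the bound on \<open>K\<close> is twice the 4 in the Chebyshev degree,
  one for each side of the conjugation. By \<open>real m \<le> K\<close> the claim is trivial once
  \<open>y > K\<close>, so that \<open>D \<ge> 1\<close> in the main case.\<close>

lemma cz_layer_approx:
  fixes F :: "nat set set" and y K :: real
  assumes F: "\<And>T. T \<in> F \<Longrightarrow> T \<subseteq> {..<m}"
    and disj: "\<And>T T'. T \<in> F \<Longrightarrow> T' \<in> F \<Longrightarrow> T \<noteq> T' \<Longrightarrow> T \<inter> T' = {}"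
    and K: "8 * real l * real m \<le> K" "real m \<le> K" "0 < K" and y: "0 < y"
  obtains h where "\<And>X. \<bar>h X\<bar> \<le> 1"
    and "\<And>X. \<bar>h X - (\<Prod>T\<in>F. cz_sign T X)\<bar> \<le> real m * 2 / 4 ^ l"
    and "\<And>A. opdeg m y A \<Longrightarrow> opdeg m (2 * (y powr (1/3) * K powr (2/3)))
           (\<lambda>X Y. complex_of_real (h X) * A X Y * complex_of_real (h Y))"
proof (cases "y \<le> K")
  case False \<comment> \<open>the claimed degree exceeds the number of qubits\<close>
  let ?h = "\<lambda>X. \<Prod>T\<in>F. cz_sign T X"
  have "K = K powr (1/3) * K powr (2/3)" using K by (simp flip: powr_add)
  also have "\<dots> \<le> y powr (1/3) * K powr (2/3)"
    using False K by (intro mult_right_mono powr_mono2) auto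
  finally have "real m \<le> 2 * (y powr (1/3) * K powr (2/3))" using K y by linarith
  then have 1: "opdeg m (2 * (y powr (1/3) * K powr (2/3))) A" for A by (rule opdeg_full)
  have 2: "\<bar>?h X\<bar> \<le> 1" for X
    unfolding abs_prod by (rule prod_le_1) (auto simp: cz_sign_def)
  show ?thesis by (rule that[of ?h]) (use 1 2 in auto)
next
  case True
  \<comment> \<open>The solution of \<open>y * D = K / sqrt D\<close>: the left side is the degree
    after the small gates, the right side what the large ones add.\<close>
  define D where "D = (K / y) powr (2/3)"
  have D: "D \<ge> 1" unfolding D_def using True y by (intro ge_one_powr_ge_zero) auto
  have yD: "y * D = y powr (1/3) * K powr (2/3)"
  proof -
    have "y * D = y powr 1 * (K powr (2/3) / y powr (2/3))"
      using y K by (simp add: D_def powr_divide)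
    also have "\<dots> = (y powr 1 / y powr (2/3)) * K powr (2/3)" by simp
    also have "y powr 1 / y powr (2/3) = y powr (1/3)" using powr_diff[of y 1 "2/3"] by simp
    finally show ?thesis .
  qed
  have KD: "K / sqrt D = y powr (1/3) * K powr (2/3)"
  proof -
    have "sqrt D = (K / y) powr (1/3)"
      unfolding D_def using K y by (simp add: powr_half_sqrt[symmetric] powr_powr)
    also have "\<dots> = K powr (1/3) / y powr (1/3)" using K y by (simp add: powr_divide)
    finally have "K / sqrt D = K powr 1 / K powr (1/3) * y powr (1/3)" using K by simp
    also have "K powr 1 / K powr (1/3) = K powr (2/3)" using powr_diff[of K 1 "1/3"] by simp
    finally show ?thesis by simp
  qed
  define B where "B = {T \<in> F. real (card T) > D}"
  define E where "E = {T \<in> F. real (card T) \<le> D}"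
  have finF: "finite F" using F by (intro finite_subset[of F "Pow {..<m}"]) auto
  have FBE: "F = B \<union> E" "B \<inter> E = {}" "finite B" "finite E" using finF by (auto simp: B_def E_def)
  have sumB: "(\<Sum>T\<in>B. real (card T)) \<le> m"
  proof -
    have "(\<Sum>T\<in>B. card T) = card (\<Union>B)"
    proof (rule card_Union_disjoint[symmetric])
      show "pairwise disjnt B" using disj by (auto simp: pairwise_def disjnt_def B_def)
      show "finite T" if "T \<in> B" for T using that F finite_subset by (auto simp: B_def)
    qed
    also have "\<dots> \<le> card {..<m}" using F by (intro card_mono) (auto simp: B_def)
    finally have "(\<Sum>T\<in>B. card T) \<le> m" by simp
    then show ?thesis by (metis of_nat_le_iff of_nat_sum)
  qed
  have "\<exists>h. mult_deg m (4 * real l * sqrt (card T)) h \<and> (\<forall>X. \<bar>h X\<bar> \<le> 1) \<and>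
      (\<forall>X. \<bar>h X - cz_sign T X\<bar> \<le> 2 / 4 ^ l)" if "T \<in> B" for T
  proof -
    have "T \<subseteq> {..<m}" "card T \<ge> 2" using that F D by (auto simp: B_def)
    from cz_sign_approx[OF this, of l] show ?thesis by metis
  qed
  then obtain g where g: "\<And>T. T \<in> B \<Longrightarrow> mult_deg m (4 * real l * sqrt (card T)) (g T)"
    "\<And>T X. T \<in> B \<Longrightarrow> \<bar>g T X\<bar> \<le> 1" "\<And>T X. T \<in> B \<Longrightarrow> \<bar>g T X - cz_sign T X\<bar> \<le> 2 / 4 ^ l"
    by metis
  define hB where "hB X = (\<Prod>T\<in>B. g T X)" for X
  define hE where "hE X = (\<Prod>T\<in>E. cz_sign T X)" for X
  have hB1: "\<bar>hB X\<bar> \<le> 1" for X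
    unfolding hB_def abs_prod using g(2) by (intro prod_le_1) auto
  have hE1: "\<bar>hE X\<bar> \<le> 1" for X
    unfolding hE_def abs_prod by (intro prod_le_1) (auto simp: cz_sign_def)
  \<comment> \<open>Half of \<open>K / sqrt D\<close>, as conjugation multiplies on both
    sides.\<close>
  have degB: "mult_deg m (K / (2 * sqrt D)) hB"
  proof -
    have "mult_deg m (\<Sum>T\<in>B. 4 * real l * sqrt (card T)) hB"
      unfolding hB_def using g(1) FBE(3) by (intro mult_deg_prod)
    moreover have "(\<Sum>T\<in>B. 4 * real l * sqrt (card T)) \<le> K / (2 * sqrt D)"
    proof -
      \<comment> \<open>A large gate has more than \<open>D\<close> qubits. This trades the square
        root for a linear term, and disjointness bounds the sum of the sizes by
        \<open>m\<close>.\<close>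
      have "sqrt (card T) \<le> real (card T) / sqrt D" if "T \<in> B" for T
      proof -
        have "sqrt D \<le> sqrt (card T)" using that by (simp add: B_def)
        then have "sqrt D * sqrt (card T) \<le> sqrt (card T) * sqrt (card T)"
          by (intro mult_right_mono) auto
        then show ?thesis using D by (simp add: field_simps)
      qed
      then have "(\<Sum>T\<in>B. 4 * real l * sqrt (card T)) \<le> (\<Sum>T\<in>B. 4 * real l * (real (card T) / sqrt D))"
        by (intro sum_mono mult_left_mono) auto
      also have "\<dots> = (4 * real l / sqrt D) * (\<Sum>T\<in>B. real (card T))"
        by (simp add: sum_distrib_left)
      also have "\<dots> \<le> (4 * real l / sqrt D) * m"
        using D sumB by (intro mult_left_mono) auto
      also have "\<dots> \<le> K / (2 * sqrt D)" using K D by (simp add: field_simps)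
      finally show ?thesis .
    qed
    ultimately show ?thesis by (rule mult_deg_mono)
  qed
  have deg: "opdeg m (2 * (y powr (1/3) * K powr (2/3)))
     (\<lambda>X Y. complex_of_real (hB X * hE X) * A X Y * complex_of_real (hB Y * hE Y))"
    if "opdeg m y A" for A
  proof -
    have "opdeg m (y * D) (\<lambda>X Y. complex_of_real (hE X) * A X Y * complex_of_real (hE Y))"
      unfolding hE_def by (rule opdeg_conj_small_cz[OF _ _ D that]) (use F disj in \<open>auto simp: E_def\<close>)
    from opdeg_conj_diag[OF degB this]
    have "opdeg m (y * D + K / sqrt D)
      (\<lambda>X Y. complex_of_real (hB X * hE X) * A X Y * complex_of_real (hB Y * hE Y))"
      by (simp add: ac_simps)
    then show ?thesis by (simp add: yD KD)
  qed
  have err: "\<bar>hB X * hE X - (\<Prod>T\<in>F. cz_sign T X)\<bar> \<le> real m * 2 / 4 ^ l" for X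
  proof -
    have "(\<Prod>T\<in>F. cz_sign T X) = (\<Prod>T\<in>B. cz_sign T X) * hE X"
      unfolding FBE(1) hE_def using FBE by (intro prod.union_disjoint)
    then have "\<bar>hB X * hE X - (\<Prod>T\<in>F. cz_sign T X)\<bar> = \<bar>hB X - (\<Prod>T\<in>B. cz_sign T X)\<bar> * \<bar>hE X\<bar>"
      by (simp add: left_diff_distrib flip: abs_mult)
    also have "\<dots> \<le> \<bar>hB X - (\<Prod>T\<in>B. cz_sign T X)\<bar>"
      using hE1[of X] by (intro mult_right_le_one_le) auto
    \<comment> \<open>Telescoping a product of numbers of modulus at most 1: the errors of the
      factors add up.\<close>
    also have "\<dots> \<le> (\<Sum>T\<in>B. \<bar>g T X - cz_sign T X\<bar>)"
      unfolding hB_def using norm_prod_diff[of B "\<lambda>T. g T X" "\<lambda>T. cz_sign T X"] g(2)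
      by (simp add: cz_sign_def)
    \<comment> \<open>The number of large gates is at most the sum of their sizes, hence at most
      \<open>m\<close>.\<close>
    also have "\<dots> \<le> (\<Sum>T\<in>B. real (card T) * (2 / 4 ^ l))"
    proof (rule sum_mono)
      fix T assume T: "T \<in> B"
      then have "real (card T) \<ge> 1" using D by (simp add: B_def)
      then have "1 * (2 / 4 ^ l) \<le> real (card T) * (2 / 4 ^ l)" by (intro mult_right_mono) auto
      with g(3)[OF T, of X] show "\<bar>g T X - cz_sign T X\<bar> \<le> real (card T) * (2 / 4 ^ l)" by linarith
    qed
    also have "\<dots> = (\<Sum>T\<in>B. real (card T)) * (2 / 4 ^ l)" by (simp only: sum_distrib_right)
    also have "\<dots> \<le> real m * (2 / 4 ^ l)" using sumB by (intro mult_right_mono) auto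
    finally show ?thesis by simp
  qed
  show ?thesis
  proof (rule that[of "\<lambda>X. hB X * hE X"])
    show "\<bar>hB X * hE X\<bar> \<le> 1" for X
      unfolding abs_mult using hB1[of X] hE1[of X] by (intro mult_le_one) auto
  qed (use err deg in auto)
qed

subsection \<open>Approximate circuits\<close>

text \<open>The diagonal layers are arbitrary real functions \<open>h\<close>, so that the exact
  circuit, with products of \<open>cz_sign\<close>, and its approximation are instances of one
  definition and can be compared layer by layer.\<close>

fun fcirc :: "nat \<Rightarrow> (nat \<Rightarrow> nat set \<Rightarrow> nat set \<Rightarrow> complex) \<Rightarrow> (nat \<Rightarrow> nat set \<Rightarrow> real) \<Rightarrow> nat \<Rightarrow>
    nat set \<Rightarrow> nat set \<Rightarrow> complex" where
  "fcirc m L h 0 = L 0"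
| "fcirc m L h (Suc j) = (\<lambda>X Y. \<Sum>Z\<in>Pow {..<m}.
     L (Suc j) X Z * (complex_of_real (h (Suc j) Z) * fcirc m L h j Z Y))"

lemma fcirc_cong:
  assumes "\<And>i. i \<le> j \<Longrightarrow> h i = h' i"
  shows "fcirc m L h j = fcirc m L h' j"
  using assms by (induction j) simp_all

lemma sum_swap4:
  "(\<Sum>a\<in>A. \<Sum>b\<in>B. \<Sum>c\<in>C. \<Sum>d\<in>D. f a b c d) = (\<Sum>c\<in>C. \<Sum>d\<in>D. \<Sum>a\<in>A. \<Sum>b\<in>B. f a b c d)"
proof -
  have "(\<Sum>a\<in>A. \<Sum>b\<in>B. \<Sum>c\<in>C. \<Sum>d\<in>D. f a b c d) = (\<Sum>a\<in>A. \<Sum>c\<in>C. \<Sum>b\<in>B. \<Sum>d\<in>D. f a b c d)"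
    by (intro sum.cong refl sum.swap)
  also have "\<dots> = (\<Sum>c\<in>C. \<Sum>a\<in>A. \<Sum>b\<in>B. \<Sum>d\<in>D. f a b c d)"
    by (rule sum.swap)
  also have "\<dots> = (\<Sum>c\<in>C. \<Sum>a\<in>A. \<Sum>d\<in>D. \<Sum>b\<in>B. f a b c d)"
    by (intro sum.cong refl sum.swap)
  also have "\<dots> = (\<Sum>c\<in>C. \<Sum>d\<in>D. \<Sum>a\<in>A. \<Sum>b\<in>B. f a b c d)"
    by (intro sum.cong refl sum.swap)
  finally show ?thesis .
qed

text \<open>In the Heisenberg picture the last layer of the circuit acts on the observable first;
  this peels it off.\<close>

lemma heis_compose:
  "heis m (\<lambda>X Y. \<Sum>Z\<in>Pow {..<m}. L X Z * (complex_of_real (h Z) * C Z Y)) A =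
   heis m C (\<lambda>Z Z'. complex_of_real (h Z) * heis m L A Z Z' * complex_of_real (h Z'))"
proof (intro ext)
  fix Y Y'
  let ?M = "Pow {..<m}"
  have "heis m (\<lambda>X Y. \<Sum>Z\<in>?M. L X Z * (complex_of_real (h Z) * C Z Y)) A Y Y' =
    (\<Sum>X\<in>?M. \<Sum>X'\<in>?M. \<Sum>Z\<in>?M. \<Sum>Z'\<in>?M.
      L X Z * (complex_of_real (h Z) * C Z Y) * A X X' * cnj (L X' Z' * (complex_of_real (h Z') * C Z' Y')))"
    by (simp only: heis_def cnj_sum sum_distrib_left sum_distrib_right)
      (intro sum.cong refl sum.swap)
  also have "\<dots> = (\<Sum>Z\<in>?M. \<Sum>Z'\<in>?M. \<Sum>X\<in>?M. \<Sum>X'\<in>?M.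
      L X Z * (complex_of_real (h Z) * C Z Y) * A X X' * cnj (L X' Z' * (complex_of_real (h Z') * C Z' Y')))"
    by (rule sum_swap4)
  also have "\<dots> = heis m C (\<lambda>Z Z'. complex_of_real (h Z) * heis m L A Z Z' * complex_of_real (h Z')) Y Y'"
    unfolding heis_def sum_distrib_left sum_distrib_right
    by (intro sum.cong refl) (simp add: ac_simps)
  finally show "heis m (\<lambda>X Y. \<Sum>Z\<in>?M. L X Z * (complex_of_real (h Z) * C Z Y)) A Y Y' =
    heis m C (\<lambda>Z Z'. complex_of_real (h Z) * heis m L A Z Z' * complex_of_real (h Z')) Y Y'" .
qed

text \<open>\<open>K'\<close> is the fixed point of the layer map from \<open>y\<close> to
  \<open>2 * (y powr (1/3) * K powr (2/3))\<close>. Measured in units of \<open>K'\<close> this map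
  is a cube root, hence the exponent \<open>1 / 3 ^ d\<close>. The choice of \<open>h\<close>
  depends on the degrees reached but not on the operator \<open>A\<close>.\<close>

lemma circuit_approx:
  fixes K K' :: real
  assumes L: "\<And>i. i \<le> d \<Longrightarrow> \<exists>u. (\<forall>k<m. col_orthonormal (u k)) \<and> L i = tensor_on {..<m} u"
    and F: "\<And>i T. i \<in> {1..d} \<Longrightarrow> T \<in> F i \<Longrightarrow> T \<subseteq> {..<m}"
    and disj: "\<And>i T T'. i \<in> {1..d} \<Longrightarrow> T \<in> F i \<Longrightarrow> T' \<in> F i \<Longrightarrow> T \<noteq> T' \<Longrightarrow> T \<inter> T' = {}"
    and K: "8 * real l * real m \<le> K" "real m \<le> K" "0 < K" and K': "K' = 2 powr (3/2) * K"
    and y: "0 < y"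
  obtains h where "\<And>i X. i \<in> {1..d} \<Longrightarrow> \<bar>h i X\<bar> \<le> 1"
    and "\<And>i X. i \<in> {1..d} \<Longrightarrow> \<bar>h i X - (\<Prod>T\<in>F i. cz_sign T X)\<bar> \<le> real m * 2 / 4 ^ l"
    and "\<And>A. opdeg m y A \<Longrightarrow> opdeg m (K' * (y / K') powr (1 / 3 ^ d)) (heis m (fcirc m L h d) A)"
proof -
  have K'0: "K' > 0" using K K' by simp
  have "\<exists>h. (\<forall>i\<in>{1..j}. \<forall>X. \<bar>h i X\<bar> \<le> 1) \<and>
      (\<forall>i\<in>{1..j}. \<forall>X. \<bar>h i X - (\<Prod>T\<in>F i. cz_sign T X)\<bar> \<le> real m * 2 / 4 ^ l) \<and>
      (\<forall>A. opdeg m y A \<longrightarrow> opdeg m (K' * (y / K') powr (1 / 3 ^ j)) (heis m (fcirc m L h j) A))"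
    if "j \<le> d" "0 < y" for j y
    using that
  \<comment> \<open>The last layer is met first and turns the degree into \<open>y1\<close>, so the
    remaining layers need the claim for another \<open>y\<close>.\<close>
  proof (induction j arbitrary: y)
    case 0
    obtain u where "\<And>k. k < m \<Longrightarrow> col_orthonormal (u k)" "L 0 = tensor_on {..<m} u"
      using L[of 0] by auto
    then have "opdeg m (K' * (y / K') powr (1 / 3 ^ 0)) (heis m (L 0) A)" if "opdeg m y A" for A
      using that opdeg_heis_tensor[of m y A u] K'0 \<open>0 < y\<close> by simp
    then show ?case by (intro exI[of _ "\<lambda>_ _. 0"]) simp
  next
    case (Suc j)
    define y1 where "y1 = 2 * (y powr (1/3) * K powr (2/3))"
    have y1: "y1 = K' * (y / K') powr (1/3)"
    proof -
      have "K' * (y / K') powr (1/3) = y powr (1/3) * (K' powr 1 / K' powr (1/3))"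
        using K'0 Suc.prems by (simp add: powr_divide)
      also have "K' powr 1 / K' powr (1/3) = K' powr (2/3)" using powr_diff[of K' 1 "1/3"] by simp
      also have "\<dots> = 2 * K powr (2/3)" using K by (simp add: K' powr_mult powr_powr)
      finally show ?thesis by (simp add: y1_def)
    qed
    have "y1 > 0" using Suc.prems K'0 by (simp add: y1)
    have j: "Suc j \<le> d" "Suc j \<in> {1..d}" using Suc.prems by auto
    obtain h0 where h0: "\<And>X. \<bar>h0 X\<bar> \<le> 1"
      "\<And>X. \<bar>h0 X - (\<Prod>T\<in>F (Suc j). cz_sign T X)\<bar> \<le> real m * 2 / 4 ^ l"
      "\<And>A. opdeg m y A \<Longrightarrow> opdeg m y1 (\<lambda>X Y. complex_of_real (h0 X) * A X Y * complex_of_real (h0 Y))"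
    proof (rule cz_layer_approx[where F = "F (Suc j)", OF _ _ K Suc.prems(2), folded y1_def])
      show "T \<subseteq> {..<m}" if "T \<in> F (Suc j)" for T using F[OF j(2) that] .
      show "T \<inter> T' = {}" if "T \<in> F (Suc j)" "T' \<in> F (Suc j)" "T \<noteq> T'" for T T'
        using disj[OF j(2) that] .
    qed (rule that)
    have "j \<le> d" using j by simp
    from Suc.IH[OF this \<open>y1 > 0\<close>]
    obtain hj where hj: "\<forall>i\<in>{1..j}. \<forall>X. \<bar>hj i X\<bar> \<le> 1"
      "\<forall>i\<in>{1..j}. \<forall>X. \<bar>hj i X - (\<Prod>T\<in>F i. cz_sign T X)\<bar> \<le> real m * 2 / 4 ^ l"
      "\<forall>A. opdeg m y1 A \<longrightarrow> opdeg m (K' * (y1 / K') powr (1 / 3 ^ j)) (heis m (fcirc m L hj j) A)"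
      by (elim exE conjE)
    obtain u where u: "\<And>k. k < m \<Longrightarrow> col_orthonormal (u k)" "L (Suc j) = tensor_on {..<m} u"
      using L[OF j(1)] by auto
    define h where "h = hj(Suc j := h0)"
    have fc: "fcirc m L h j = fcirc m L hj j" by (rule fcirc_cong) (simp add: h_def)
    have exp: "(y1 / K') powr (1 / 3 ^ j) = (y / K') powr (1 / 3 ^ Suc j)"
      using K'0 by (simp add: y1 powr_powr)
    have "opdeg m (K' * (y / K') powr (1 / 3 ^ Suc j)) (heis m (fcirc m L h (Suc j)) A)"
      if "opdeg m y A" for A
      using hj(3)[rule_format, OF h0(3)[OF opdeg_heis_tensor[OF that u(1)]]]
      unfolding fcirc.simps heis_compose fc exp by (simp add: h_def u(2))
    moreover have "\<bar>h i X\<bar> \<le> 1" if "i \<in> {1..Suc j}" for i X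
      using hj(1) h0(1) that by (cases "i = Suc j") (simp_all add: h_def)
    moreover have "\<bar>h i X - (\<Prod>T\<in>F i. cz_sign T X)\<bar> \<le> real m * 2 / 4 ^ l" if "i \<in> {1..Suc j}" for i X
      using hj(2) h0(2) that by (cases "i = Suc j") (simp_all add: h_def)
    ultimately show ?case by (intro exI[of _ h] conjI ballI allI impI)
  qed
  from this[OF order_refl y] obtain h where h: "\<forall>i\<in>{1..d}. \<forall>X. \<bar>h i X\<bar> \<le> 1"
      "\<forall>i\<in>{1..d}. \<forall>X. \<bar>h i X - (\<Prod>T\<in>F i. cz_sign T X)\<bar> \<le> real m * 2 / 4 ^ l"
      "\<forall>A. opdeg m y A \<longrightarrow> opdeg m (K' * (y / K') powr (1 / 3 ^ d)) (heis m (fcirc m L h d) A)"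
    by (elim exE conjE)
  show ?thesis by (rule that[of h]) (simp_all add: h del: One_nat_def)
qed

subsection \<open>The seminorm of an ancilla state\<close>

definition qform :: "nat \<Rightarrow> (nat set \<Rightarrow> nat set \<Rightarrow> complex) \<Rightarrow> (nat set \<Rightarrow> complex) \<Rightarrow> (nat set \<Rightarrow> complex) \<Rightarrow> complex" where
  "qform a \<Phi> v w = (\<Sum>I\<in>Pow {..<a}. \<Sum>J\<in>Pow {..<a}. v I * \<Phi> I J * cnj (w J))"

text \<open>For an operator \<open>W\<close> from the ancillas to the whole register this is the
  real part of the trace of \<open>P W \<Phi> W\<^sup>*\<close>, with \<open>P\<close> the
  projection onto the basis states in \<open>\<X>\<close>. All basis states give the square of the
  seminorm, those with output bit 1 the acceptance probability.\<close>

definition sqnorm :: "nat \<Rightarrow> (nat set \<Rightarrow> nat set \<Rightarrow> complex) \<Rightarrow> nat set set \<Rightarrow>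
    (nat set \<Rightarrow> nat set \<Rightarrow> complex) \<Rightarrow> real" where
  "sqnorm a \<Phi> \<X> W = (\<Sum>X\<in>\<X>. Re (qform a \<Phi> (W X) (W X)))"

lemma qform_add_left: "qform a \<Phi> (\<lambda>I. v I + v' I) w = qform a \<Phi> v w + qform a \<Phi> v' w"
  by (simp add: qform_def distrib_right sum.distrib)

lemma qform_add_right: "qform a \<Phi> v (\<lambda>I. w I + w' I) = qform a \<Phi> v w + qform a \<Phi> v w'"
  by (simp add: qform_def distrib_left sum.distrib)

lemma qform_scale_left: "qform a \<Phi> (\<lambda>I. c * v I) w = c * qform a \<Phi> v w"
  by (simp add: qform_def sum_distrib_left ac_simps)

lemma qform_scale_right: "qform a \<Phi> v (\<lambda>I. c * w I) = cnj c * qform a \<Phi> v w"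
  by (simp add: qform_def sum_distrib_left ac_simps)

lemma qform_sum_left:
  "finite A \<Longrightarrow> qform a \<Phi> (\<lambda>I. \<Sum>z\<in>A. v z I) w = (\<Sum>z\<in>A. qform a \<Phi> (v z) w)"
  by (induction A rule: finite_induct) (simp_all add: qform_add_left, simp add: qform_def)

lemma qform_sum_right:
  "finite A \<Longrightarrow> qform a \<Phi> v (\<lambda>I. \<Sum>z\<in>A. w z I) = (\<Sum>z\<in>A. qform a \<Phi> v (w z))"
  by (induction A rule: finite_induct) (simp_all add: qform_add_right, simp add: qform_def)

text \<open>Supplies Cauchy-Schwarz for a form that may be degenerate, hence the separate case
  \<open>q = 0\<close>.\<close>

lemma nonneg_quadratic_discriminant:
  fixes p b q :: real
  assumes nn: "\<And>t. 0 \<le> p + t * b + t\<^sup>2 * q" and q: "0 \<le> q"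
  shows "b\<^sup>2 \<le> 4 * p * q"
proof (cases "q = 0")
  case True
  have "b = 0"
  proof (rule ccontr)
    assume "b \<noteq> 0"
    \<comment> \<open>With \<open>q = 0\<close> the polynomial is linear, and this \<open>t\<close>
      gives it the value -1.\<close>
    then show False using nn[of "- (p + 1) / b"] True by (simp add: field_simps)
  qed
  then show ?thesis using True by simp
next
  case False
  with q have "q > 0" by simp
  then show ?thesis using nn[of "- b / (2 * q)"] by (simp add: field_simps power2_eq_square)
qed

text \<open>A quadratic polynomial in \<open>t\<close>; its discriminant bounds the cross term in
  the triangle inequality.\<close>

lemma sqnorm_expand:
  "sqnorm a \<Phi> \<X> (\<lambda>X I. W X I + complex_of_real t * V X I) = sqnorm a \<Phi> \<X> W +
     t * (\<Sum>X\<in>\<X>. Re (qform a \<Phi> (W X) (V X) + qform a \<Phi> (V X) (W X))) + t\<^sup>2 * sqnorm a \<Phi> \<X> V"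
  unfolding sqnorm_def sum_distrib_left sum.distrib[symmetric]
  by (intro sum.cong refl)
    (simp add: qform_add_left qform_add_right qform_scale_left qform_scale_right algebra_simps power2_eq_square)

locale psd_kernel =
  fixes a :: nat and \<Phi> :: "nat set \<Rightarrow> nat set \<Rightarrow> complex"
  assumes psd: "0 \<le> Re (qform a \<Phi> v v)"
begin

lemma sqnorm_nonneg: "0 \<le> sqnorm a \<Phi> \<X> W"
  unfolding sqnorm_def by (intro sum_nonneg psd)

lemma sqnorm_mono: "finite \<Y> \<Longrightarrow> \<X> \<subseteq> \<Y> \<Longrightarrow> sqnorm a \<Phi> \<X> W \<le> sqnorm a \<Phi> \<Y> W"
  unfolding sqnorm_def by (intro sum_mono2 psd)

lemma sqnorm_triangle:
  "sqrt (sqnorm a \<Phi> \<X> (\<lambda>X I. W X I + V X I)) \<le> sqrt (sqnorm a \<Phi> \<X> W) + sqrt (sqnorm a \<Phi> \<X> V)"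
proof -
  let ?p = "sqnorm a \<Phi> \<X> W" and ?q = "sqnorm a \<Phi> \<X> V"
  let ?b = "\<Sum>X\<in>\<X>. Re (qform a \<Phi> (W X) (V X) + qform a \<Phi> (V X) (W X))"
  have "?b\<^sup>2 \<le> 4 * ?p * ?q"
    by (rule nonneg_quadratic_discriminant, subst sqnorm_expand[symmetric]) (rule sqnorm_nonneg)+
  then have "?b \<le> sqrt (4 * ?p * ?q)" by (rule real_le_rsqrt)
  then have b: "?b \<le> 2 * (sqrt ?p * sqrt ?q)" by (simp add: real_sqrt_mult)
  have "sqnorm a \<Phi> \<X> (\<lambda>X I. W X I + V X I) = ?p + ?b + ?q"
    using sqnorm_expand[of a \<Phi> \<X> W 1 V] by simp
  also have "\<dots> \<le> (sqrt ?p + sqrt ?q)\<^sup>2"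
    using b sqnorm_nonneg by (simp add: power2_sum)
  finally show ?thesis using sqnorm_nonneg by (intro real_le_lsqrt) auto
qed

lemma sqnorm_diag:
  assumes "\<And>X. X \<in> \<X> \<Longrightarrow> \<bar>h X\<bar> \<le> c"
  shows "sqrt (sqnorm a \<Phi> \<X> (\<lambda>X I. complex_of_real (h X) * W X I)) \<le> \<bar>c\<bar> * sqrt (sqnorm a \<Phi> \<X> W)"
proof -
  have "sqnorm a \<Phi> \<X> (\<lambda>X I. complex_of_real (h X) * W X I) = (\<Sum>X\<in>\<X>. (h X)\<^sup>2 * Re (qform a \<Phi> (W X) (W X)))"
    by (simp add: sqnorm_def qform_scale_left qform_scale_right power2_eq_square mult.assoc)
  also have "\<dots> \<le> (\<Sum>X\<in>\<X>. c\<^sup>2 * Re (qform a \<Phi> (W X) (W X)))"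
    using psd order_trans[OF assms abs_ge_self]
    by (intro sum_mono mult_right_mono) (auto simp: abs_le_square_iff[symmetric])
  also have "\<dots> = c\<^sup>2 * sqnorm a \<Phi> \<X> W" by (simp add: sqnorm_def sum_distrib_left)
  finally have "sqrt (sqnorm a \<Phi> \<X> (\<lambda>X I. complex_of_real (h X) * W X I)) \<le> sqrt (c\<^sup>2 * sqnorm a \<Phi> \<X> W)"
    by (rule real_sqrt_le_mono)
  then show ?thesis by (simp add: real_sqrt_mult)
qed

text \<open>A difference of squares: \<open>\<bar>w\<^sup>2 - v\<^sup>2\<bar> = \<bar>w - v\<bar> *
  (w + v)\<close> with \<open>w\<close> and \<open>v\<close> at most 1. Passing from
  \<open>\<Y>\<close> to \<open>\<X>\<close> is a projection, which does not increase the
  seminorm.\<close>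

lemma sqnorm_diff_le:
  assumes "\<X> \<subseteq> \<Y>" "finite \<Y>" "sqrt (sqnorm a \<Phi> \<Y> W) \<le> 1" "sqrt (sqnorm a \<Phi> \<Y> V) \<le> 1"
    and D: "sqrt (sqnorm a \<Phi> \<Y> (\<lambda>X I. W X I - V X I)) \<le> e"
  shows "\<bar>sqnorm a \<Phi> \<X> W - sqnorm a \<Phi> \<X> V\<bar> \<le> 2 * e"
proof -
  let ?w = "sqrt (sqnorm a \<Phi> \<X> W)" and ?v = "sqrt (sqnorm a \<Phi> \<X> V)"
  let ?d = "sqrt (sqnorm a \<Phi> \<X> (\<lambda>X I. W X I - V X I))"
  have mono: "sqrt (sqnorm a \<Phi> \<X> U) \<le> sqrt (sqnorm a \<Phi> \<Y> U)" for U
    using sqnorm_mono[OF assms(2,1)] by simp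
  have "?w \<le> ?v + ?d" using sqnorm_triangle[of \<X> V "\<lambda>X I. W X I - V X I"] by simp
  \<comment> \<open>The negated difference has the same seminorm, by \<open>sqnorm_expand\<close> at
    \<open>t = - 1\<close> starting from the zero operator.\<close>
  moreover have "?v \<le> ?w + ?d"
    using sqnorm_triangle[of \<X> W "\<lambda>X I. - (W X I - V X I)"]
      sqnorm_expand[of a \<Phi> \<X> "\<lambda>_ _. 0" "- 1" "\<lambda>X I. W X I - V X I"]
    by (simp add: sqnorm_def qform_def)
  ultimately have 1: "\<bar>?w - ?v\<bar> \<le> e" using D mono[of "\<lambda>X I. W X I - V X I"] by linarith
  have 2: "?w + ?v \<le> 2" using mono[of W] mono[of V] assms(3,4) by linarith
  have 3: "0 \<le> ?w + ?v" using sqnorm_nonneg by simp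
  have "sqnorm a \<Phi> \<X> W - sqnorm a \<Phi> \<X> V = (?w - ?v) * (?w + ?v)"
    using sqnorm_nonneg by (simp add: algebra_simps)
  then have "\<bar>sqnorm a \<Phi> \<X> W - sqnorm a \<Phi> \<X> V\<bar> = \<bar>?w - ?v\<bar> * (?w + ?v)"
    using 3 by (simp add: abs_mult)
  also have "\<dots> \<le> e * 2" using 1 2 3 by (intro mult_mono) auto
  finally show ?thesis by simp
qed

end

text \<open>A layer of single-qubit unitaries is an isometry: after expanding both arguments, the
  sum over \<open>X\<close> leaves only \<open>Z = Z'\<close>.\<close>

lemma sqnorm_tensor:
  assumes "\<And>k. k < m \<Longrightarrow> col_orthonormal (u k)"
  shows "sqnorm a \<Phi> (Pow {..<m}) (\<lambda>X I. \<Sum>Z\<in>Pow {..<m}. tensor_on {..<m} u X Z * W Z I) =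
    sqnorm a \<Phi> (Pow {..<m}) W"
proof -
  let ?M = "Pow {..<m}" and ?L = "tensor_on {..<m} u"
  have "(\<Sum>X\<in>?M. qform a \<Phi> (\<lambda>I. \<Sum>Z\<in>?M. ?L X Z * W Z I) (\<lambda>I. \<Sum>Z\<in>?M. ?L X Z * W Z I)) =
    (\<Sum>X\<in>?M. \<Sum>Z\<in>?M. \<Sum>Z'\<in>?M. (?L X Z * cnj (?L X Z')) * qform a \<Phi> (W Z) (W Z'))"
    by (simp add: qform_sum_left qform_sum_right qform_scale_left qform_scale_right sum_distrib_left mult.assoc mult.left_commute)
  also have "\<dots> = (\<Sum>Z\<in>?M. \<Sum>X\<in>?M. \<Sum>Z'\<in>?M. (?L X Z * cnj (?L X Z')) * qform a \<Phi> (W Z) (W Z'))"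
    by (rule sum.swap)
  also have "\<dots> = (\<Sum>Z\<in>?M. \<Sum>Z'\<in>?M. (\<Sum>X\<in>?M. ?L X Z * cnj (?L X Z')) * qform a \<Phi> (W Z) (W Z'))"
    unfolding sum_distrib_right by (intro sum.cong refl sum.swap)
  also have "\<dots> = (\<Sum>Z\<in>?M. \<Sum>Z'\<in>?M. if Z = Z' then qform a \<Phi> (W Z) (W Z') else 0)"
  proof (intro sum.cong refl)
    fix Z Z' assume "Z \<in> ?M" "Z' \<in> ?M"
    then have "Z \<inter> {..<m} = Z" "Z' \<inter> {..<m} = Z'" by auto
    then show "(\<Sum>X\<in>?M. ?L X Z * cnj (?L X Z')) * qform a \<Phi> (W Z) (W Z') =
        (if Z = Z' then qform a \<Phi> (W Z) (W Z') else 0)"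
      using tensor_on_orthonormal[of "{..<m}" u Z Z'] assms by simp
  qed
  also have "\<dots> = (\<Sum>Z\<in>?M. qform a \<Phi> (W Z) (W Z))"
    by (intro sum.cong refl) (simp add: sum.delta)
  finally show ?thesis unfolding sqnorm_def Re_sum[symmetric] by simp
qed

text \<open>\<open>\<iota>\<close> will place the ancilla state next to a fixed input. By
  injectivity only the diagonal of \<open>\<Phi>\<close> survives, so the initial state has seminorm
  1 once the trace is 1.\<close>

lemma sqnorm_embedding:
  assumes "inj_on \<iota> (Pow {..<a})" "\<iota> ` Pow {..<a} \<subseteq> Pow {..<m}"
  shows "sqnorm a \<Phi> (Pow {..<m}) (\<lambda>Z I. of_bool (Z = \<iota> I)) = Re (\<Sum>I\<in>Pow {..<a}. \<Phi> I I)"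
proof -
  let ?M = "Pow {..<m}" and ?A = "Pow {..<a}"
  have "(\<Sum>Z\<in>?M. qform a \<Phi> (\<lambda>I. of_bool (Z = \<iota> I)) (\<lambda>I. of_bool (Z = \<iota> I))) =
    (\<Sum>I\<in>?A. \<Sum>Z\<in>?M. \<Sum>J\<in>?A. of_bool (Z = \<iota> I) * \<Phi> I J * cnj (of_bool (Z = \<iota> J)))"
    unfolding qform_def by (rule sum.swap)
  also have "\<dots> = (\<Sum>I\<in>?A. \<Sum>J\<in>?A. \<Sum>Z\<in>?M. of_bool (Z = \<iota> I) * \<Phi> I J * cnj (of_bool (Z = \<iota> J)))"
    by (intro sum.cong refl sum.swap)
  also have "\<dots> = (\<Sum>I\<in>?A. \<Sum>J\<in>?A. if J = I then \<Phi> I J else 0)"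
  proof (intro sum.cong refl)
    fix I J assume IJ: "I \<in> ?A" "J \<in> ?A"
    have "(\<Sum>Z\<in>?M. of_bool (Z = \<iota> I) * \<Phi> I J * cnj (of_bool (Z = \<iota> J))) =
      (\<Sum>Z\<in>?M. if Z = \<iota> I then \<Phi> I J * of_bool (\<iota> I = \<iota> J) else 0)"
      by (intro sum.cong) auto
    also have "\<dots> = \<Phi> I J * of_bool (\<iota> I = \<iota> J)"
      using IJ assms(2) by (simp add: sum.delta image_subset_iff)
    also have "\<dots> = (if J = I then \<Phi> I J else 0)"
      using inj_onD[OF assms(1), of I J] IJ by auto
    finally show "(\<Sum>Z\<in>?M. of_bool (Z = \<iota> I) * \<Phi> I J * cnj (of_bool (Z = \<iota> J))) = (if J = I then \<Phi> I J else 0)" .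
  qed
  also have "\<dots> = (\<Sum>I\<in>?A. \<Phi> I I)" by (intro sum.cong refl) (simp add: sum.delta)
  finally show ?thesis unfolding sqnorm_def Re_sum[symmetric] by simp
qed

text \<open>A hybrid argument. Neither single-qubit layers nor diagonal layers bounded by 1 increase
  the seminorm, so an error made in one layer is not amplified by later ones and the
  \<open>d\<close> errors add up.\<close>

lemma (in psd_kernel) fcirc_close:
  assumes L: "\<And>i. i \<le> d \<Longrightarrow> \<exists>u. (\<forall>k<m. col_orthonormal (u k)) \<and> L i = tensor_on {..<m} u"
    and g: "\<And>i X. i \<in> {1..d} \<Longrightarrow> \<bar>g i X\<bar> \<le> 1" and h: "\<And>i X. i \<in> {1..d} \<Longrightarrow> \<bar>h i X\<bar> \<le> 1"
    and gh: "\<And>i X. i \<in> {1..d} \<Longrightarrow> \<bar>g i X - h i X\<bar> \<le> \<delta>"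
    and \<iota>: "inj_on \<iota> (Pow {..<a})" "\<iota> ` Pow {..<a} \<subseteq> Pow {..<m}"
    and tr: "Re (\<Sum>I\<in>Pow {..<a}. \<Phi> I I) = 1"
  shows "sqrt (sqnorm a \<Phi> (Pow {..<m}) (\<lambda>X I. fcirc m L g d X (\<iota> I))) \<le> 1"
    and "sqrt (sqnorm a \<Phi> (Pow {..<m}) (\<lambda>X I. fcirc m L g d X (\<iota> I) - fcirc m L h d X (\<iota> I))) \<le> real d * \<delta>"
proof -
  let ?M = "Pow {..<m}"
  let ?s = "\<lambda>W. sqrt (sqnorm a \<Phi> ?M W)"
  have "?s (\<lambda>X I. fcirc m L g j X (\<iota> I)) \<le> 1 \<and>
    ?s (\<lambda>X I. fcirc m L g j X (\<iota> I) - fcirc m L h j X (\<iota> I)) \<le> real j * \<delta>" if "j \<le> d" for j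
    using that
  proof (induction j)
    case 0
    obtain u where u: "\<And>k. k < m \<Longrightarrow> col_orthonormal (u k)" "L 0 = tensor_on {..<m} u"
      using L[of 0] by auto
    have "sqnorm a \<Phi> ?M (\<lambda>X I. L 0 X (\<iota> I)) = sqnorm a \<Phi> ?M (\<lambda>X I. \<Sum>Z\<in>?M. L 0 X Z * of_bool (Z = \<iota> I))"
      unfolding sqnorm_def qform_def using \<iota>(2)
      by (intro sum.cong refl arg_cong[where f = Re]) (simp add: image_subset_iff of_bool_def if_distrib sum.delta cong: if_cong)
    also have "\<dots> = 1" unfolding u(2) by (simp only: sqnorm_tensor[OF u(1)] sqnorm_embedding[OF \<iota>] tr)
    finally show ?case by (simp add: sqnorm_def qform_def)
  next
    case (Suc j)
    obtain u where u: "\<And>k. k < m \<Longrightarrow> col_orthonormal (u k)" "L (Suc j) = tensor_on {..<m} u"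
      using L[OF Suc.prems] by auto
    have j: "Suc j \<in> {1..d}" using Suc.prems by auto
    let ?W = "\<lambda>X I. fcirc m L g j X (\<iota> I)" and ?V = "\<lambda>X I. fcirc m L h j X (\<iota> I)"
    have IH: "?s ?W \<le> 1" "?s (\<lambda>X I. ?W X I - ?V X I) \<le> real j * \<delta>" using Suc by auto
    have \<delta>: "\<delta> \<ge> 0" using gh[OF j, of "{}"] by linarith
    have "?s (\<lambda>X I. fcirc m L g (Suc j) X (\<iota> I)) = ?s (\<lambda>X I. complex_of_real (g (Suc j) X) * ?W X I)"
      unfolding fcirc.simps u(2) by (simp only: sqnorm_tensor[OF u(1)])
    also have "\<dots> \<le> \<bar>1\<bar> * ?s ?W" by (rule sqnorm_diag) (rule g[OF j])
    finally have 1: "?s (\<lambda>X I. fcirc m L g (Suc j) X (\<iota> I)) \<le> 1" using IH by simp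
    \<comment> \<open>Exchanging one layer:
      \<open>g W - h V = (g - h) W + h (W - V)\<close>.\<close>
    have "(\<lambda>X I. fcirc m L g (Suc j) X (\<iota> I) - fcirc m L h (Suc j) X (\<iota> I)) =
      (\<lambda>X I. \<Sum>Z\<in>?M. tensor_on {..<m} u X Z *
         (complex_of_real (g (Suc j) Z - h (Suc j) Z) * ?W Z I + complex_of_real (h (Suc j) Z) * (?W Z I - ?V Z I)))"
      by (simp add: u(2) algebra_simps flip: sum_subtractf)
    then have "?s (\<lambda>X I. fcirc m L g (Suc j) X (\<iota> I) - fcirc m L h (Suc j) X (\<iota> I)) =
      ?s (\<lambda>Z I. complex_of_real (g (Suc j) Z - h (Suc j) Z) * ?W Z I + complex_of_real (h (Suc j) Z) * (?W Z I - ?V Z I))"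
      by (simp only: sqnorm_tensor[OF u(1)])
    also have "\<dots> \<le> ?s (\<lambda>Z I. complex_of_real (g (Suc j) Z - h (Suc j) Z) * ?W Z I) +
        ?s (\<lambda>Z I. complex_of_real (h (Suc j) Z) * (?W Z I - ?V Z I))"
      by (rule sqnorm_triangle)
    also have "\<dots> \<le> \<bar>\<delta>\<bar> * ?s ?W + \<bar>1\<bar> * ?s (\<lambda>Z I. ?W Z I - ?V Z I)"
      by (intro add_mono sqnorm_diag gh[OF j] h[OF j])
    also have "\<dots> \<le> \<delta> * 1 + real j * \<delta>"
      using \<delta> IH mult_left_mono[OF IH(1) \<delta>] by simp
    finally show ?case using 1 by (simp add: algebra_simps)
  qed
  from this[of d] show "?s (\<lambda>X I. fcirc m L g d X (\<iota> I)) \<le> 1"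
    "?s (\<lambda>X I. fcirc m L g d X (\<iota> I) - fcirc m L h d X (\<iota> I)) \<le> real d * \<delta>" by auto
qed

subsection \<open>Fourier degree of acceptance probabilities\<close>

definition flip :: "nat \<Rightarrow> nat set \<Rightarrow> nat set" where
  "flip k x = (if k \<in> x then x - {k} else insert k x)"

lemma flip_flip: "flip k (flip k x) = x"
  by (auto simp: flip_def)

lemma chi_flip:
  assumes "finite T" "k \<in> T"
  shows "chi T (flip k x) = - chi T x"
proof -
  have *: "chi T (insert k x) = - chi T x" if "k \<notin> x" for x
  proof -
    have "T \<inter> insert k x = insert k (T \<inter> x)" using assms by blast
    then show ?thesis using that assms by (simp add: chi_def)
  qed
  show ?thesis
  proof (cases "k \<in> x")
    case True
    then show ?thesis using *[of "x - {k}"] by (simp add: flip_def insert_absorb)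
  qed (simp add: * flip_def)
qed

text \<open>Pairing \<open>x\<close> with \<open>flip k x\<close> fixes \<open>g\<close> and
  reverses the sign of the character.\<close>

lemma fourier_coeff_flip_invariant:
  assumes T: "k \<in> T" "T \<subseteq> {..<n}" and g: "\<And>x. x \<subseteq> {..<n} \<Longrightarrow> g (flip k x) = g x"
  shows "fourier_coeff n g T = 0"
proof -
  have fin: "finite T" using T finite_subset by blast
  have "(\<Sum>x\<in>Pow {..<n}. g x * chi T x) = (\<Sum>x\<in>Pow {..<n}. g (flip k x) * chi T (flip k x))"
    by (rule sum.reindex_bij_witness[of _ "flip k" "flip k"])
      (use T in \<open>auto simp: flip_flip\<close>, auto simp: flip_def split: if_splits)
  also have "\<dots> = - (\<Sum>x\<in>Pow {..<n}. g x * chi T x)"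
    unfolding sum_negf[symmetric] using g by (intro sum.cong refl) (simp add: chi_flip[OF fin T(1)])
  finally show ?thesis by (simp add: fourier_coeff_def)
qed

definition with_ancilla :: "nat \<Rightarrow> nat set \<Rightarrow> nat set \<Rightarrow> nat set" where
  "with_ancilla n x I = x \<union> (\<lambda>k. k + n) ` I"

lemma inj_on_with_ancilla:
  assumes "x \<subseteq> {..<n}"
  shows "inj_on (with_ancilla n x) (Pow {..<a})"
proof (rule inj_onI)
  fix I J assume eq: "with_ancilla n x I = with_ancilla n x J"
  have "I = {k. k + n \<in> with_ancilla n x I}" for I
    using assms by (auto simp: with_ancilla_def)
  then show "I = J" using eq by metis
qed

lemma with_ancilla_subset:
  "x \<subseteq> {..<n} \<Longrightarrow> I \<subseteq> {..<a} \<Longrightarrow> with_ancilla n x I \<subseteq> {..<n + a}"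
  by (auto simp: with_ancilla_def)

text \<open>A set \<open>T\<close> of more than \<open>y\<close> inputs contains, for each local
  summand, some \<open>k\<close> outside its support. Both indices carry the same \<open>x\<close>,
  so flipping bit \<open>k\<close> affects neither the kernel inside the support nor the agreement
  outside it.\<close>

lemma fourier_coeff_opdeg:
  assumes "opdeg (n + a) y A" and T: "T \<subseteq> {..<n}" "y < real (card T)"
  shows "fourier_coeff n (\<lambda>x. Re (\<Sum>I\<in>Pow {..<a}. \<Sum>J\<in>Pow {..<a}.
           A (with_ancilla n x I) (with_ancilla n x J) * \<Phi> I J)) T = 0"
  using assms(1)
proof induction
  case (supported S A)
  from supported(3) obtain f where f: "\<And>X Y. X \<subseteq> {..<n + a} \<Longrightarrow> Y \<subseteq> {..<n + a} \<Longrightarrow>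
     A X Y = (if X - S = Y - S then f (X \<inter> S) (Y \<inter> S) else 0)"
    unfolding supported_on_def by metis
  have "finite S" using supported(1) finite_subset by blast
  have "\<not> T \<subseteq> S"
  proof
    assume "T \<subseteq> S"
    from card_mono[OF \<open>finite S\<close> this] show False using T supported(2) by linarith
  qed
  then obtain k where k: "k \<in> T" "k \<notin> S" by blast
  have kn: "k < n" using k T by blast
  have A: "A (with_ancilla n (flip k x) I) (with_ancilla n (flip k x) J) =
      A (with_ancilla n x I) (with_ancilla n x J)"
    if x: "x \<subseteq> {..<n}" and IJ: "I \<in> Pow {..<a}" "J \<in> Pow {..<a}" for x I J
  proof -
    have x': "flip k x \<subseteq> {..<n}" using x kn by (auto simp: flip_def)
    have 1: "with_ancilla n (flip k x) I \<inter> S = with_ancilla n x I \<inter> S" for I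
      using k by (auto simp: with_ancilla_def flip_def)
    have "with_ancilla n z I - S = with_ancilla n z J - S \<longleftrightarrow> (\<lambda>k. k + n) ` I - S = (\<lambda>k. k + n) ` J - S"
      if "z \<subseteq> {..<n}" for z
      using that by (auto simp: with_ancilla_def)
    then have 2: "with_ancilla n (flip k x) I - S = with_ancilla n (flip k x) J - S \<longleftrightarrow>
        with_ancilla n x I - S = with_ancilla n x J - S"
      using x x' by metis
    have sub: "with_ancilla n z I \<subseteq> {..<n + a}" "with_ancilla n z J \<subseteq> {..<n + a}" if "z \<subseteq> {..<n}" for z
      using with_ancilla_subset[OF that] IJ by blast+
    show ?thesis by (simp only: f[OF sub[OF x]] f[OF sub[OF x']] 1 2)
  qed
  show ?case
    by (rule fourier_coeff_flip_invariant[OF k(1) T(1)]) (simp add: A)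
next
  case (add A B)
  have lin: "fourier_coeff n (\<lambda>x. g x + h x) T = fourier_coeff n g T + fourier_coeff n h T" for g h
    by (simp add: fourier_coeff_def distrib_right sum.distrib add_divide_distrib)
  from add.IH show ?case
    by (simp only: distrib_right sum.distrib plus_complex.sel lin)
qed

text \<open>Nonnegativity of \<open>y\<close> covers the 0 inserted into the maximum in
  \<open>fdeg\<close>.\<close>

lemma approx_deg_le:
  assumes "0 \<le> y" "\<And>T. T \<subseteq> {..<n} \<Longrightarrow> y < real (card T) \<Longrightarrow> fourier_coeff n g T = 0"
    and "\<And>x. x \<subseteq> {..<n} \<Longrightarrow> \<bar>f x - g x\<bar> \<le> \<epsilon>"
  shows "real (approx_deg n \<epsilon> f) \<le> y"
proof -
  let ?S = "insert 0 {card S | S. S \<subseteq> {..<n} \<and> fourier_coeff n g S \<noteq> 0}"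
  have "finite ?S" by simp
  then have "fdeg n g \<in> ?S" unfolding fdeg_def by (intro Max_in) auto
  then have "real (fdeg n g) \<le> y"
  proof
    assume "fdeg n g \<in> {card S | S. S \<subseteq> {..<n} \<and> fourier_coeff n g S \<noteq> 0}"
    then obtain S where "fdeg n g = card S" "S \<subseteq> {..<n}" "fourier_coeff n g S \<noteq> 0" by blast
    then show ?thesis using assms(2)[of S] by (metis not_le)
  qed (use assms(1) in simp)
  moreover have "approx_deg n \<epsilon> f \<le> fdeg n g"
    unfolding approx_deg_def by (rule Least_le) (use assms(3) in auto)
  ultimately show ?thesis by linarith
qed

text \<open>Passes from the Schroedinger to the Heisenberg picture: cyclicity of the trace, with the
  projection onto \<open>\<X>\<close> as observable.\<close>

lemma sqnorm_eq_heis: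
  assumes "\<X> \<subseteq> Pow {..<m}"
  shows "sqnorm a \<Phi> \<X> (\<lambda>X I. U X (\<iota> I)) = Re (\<Sum>I\<in>Pow {..<a}. \<Sum>J\<in>Pow {..<a}.
     heis m U (\<lambda>X X'. of_bool (X = X' \<and> X \<in> \<X>)) (\<iota> I) (\<iota> J) * \<Phi> I J)"
proof -
  let ?M = "Pow {..<m}" and ?A = "Pow {..<a}"
  have h: "heis m U (\<lambda>X X'. of_bool (X = X' \<and> X \<in> \<X>)) Y Z = (\<Sum>X\<in>\<X>. U X Y * cnj (U X Z))" for Y Z
  proof -
    have "heis m U (\<lambda>X X'. of_bool (X = X' \<and> X \<in> \<X>)) Y Z =
      (\<Sum>X\<in>?M. \<Sum>X'\<in>?M. if X = X' then (if X \<in> \<X> then U X Y * cnj (U X' Z) else 0) else 0)"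
      unfolding heis_def by (intro sum.cong refl) auto
    also have "\<dots> = (\<Sum>X\<in>?M. if X \<in> \<X> then U X Y * cnj (U X Z) else 0)"
      by (intro sum.cong refl) (simp add: sum.delta')
    also have "\<dots> = (\<Sum>X\<in>?M \<inter> \<X>. U X Y * cnj (U X Z))" by (simp add: sum.inter_restrict)
    also have "?M \<inter> \<X> = \<X>" using assms by blast
    finally show ?thesis .
  qed
  have "(\<Sum>I\<in>?A. \<Sum>J\<in>?A. heis m U (\<lambda>X X'. of_bool (X = X' \<and> X \<in> \<X>)) (\<iota> I) (\<iota> J) * \<Phi> I J) =
    (\<Sum>I\<in>?A. \<Sum>J\<in>?A. \<Sum>X\<in>\<X>. U X (\<iota> I) * \<Phi> I J * cnj (U X (\<iota> J)))"
    unfolding h sum_distrib_right by (intro sum.cong refl) (simp add: ac_simps)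
  also have "\<dots> = (\<Sum>I\<in>?A. \<Sum>X\<in>\<X>. \<Sum>J\<in>?A. U X (\<iota> I) * \<Phi> I J * cnj (U X (\<iota> J)))"
    by (intro sum.cong refl sum.swap)
  also have "\<dots> = (\<Sum>X\<in>\<X>. \<Sum>I\<in>?A. \<Sum>J\<in>?A. U X (\<iota> I) * \<Phi> I J * cnj (U X (\<iota> J)))"
    by (rule sum.swap)
  finally show ?thesis by (simp add: sqnorm_def qform_def)
qed

lemma supported_on_output: "supported_on m {0} (\<lambda>X X'. of_bool (X = X' \<and> X \<in> {X \<in> Pow {..<m}. 0 \<in> X}))"
proof (rule supported_onI[where f = "\<lambda>P Q. of_bool (0 \<in> P \<and> 0 \<in> Q)"])
  fix X Y :: "nat set"
  assume "X \<subseteq> {..<m}" "Y \<subseteq> {..<m}"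
  then have *: "X = Y \<and> X \<in> {X \<in> Pow {..<m}. 0 \<in> X} \<longleftrightarrow>
      X - {0} = Y - {0} \<and> 0 \<in> X \<inter> {0} \<and> 0 \<in> Y \<inter> {0}"
    by blast
  show "of_bool (X = Y \<and> X \<in> {X \<in> Pow {..<m}. 0 \<in> X}) =
      (if X - {0} = Y - {0} then of_bool (0 \<in> X \<inter> {0} \<and> 0 \<in> Y \<inter> {0}) else (0 :: complex))"
    unfolding * by (cases "X - {0} = Y - {0}") (simp_all only: simp_thms if_True if_False of_bool_eq)
qed

subsection \<open>Matrices indexed by sets of qubits\<close>

text \<open>\<open>set_encode\<close> stores membership of \<open>k\<close> as bit \<open>k\<close>,
  which is the convention of \<open>qbit\<close>.\<close>

definition set_entry :: "complex mat \<Rightarrow> nat set \<Rightarrow> nat set \<Rightarrow> complex" where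
  "set_entry U X Y = U $$ (set_encode X, set_encode Y)"

lemma qbit_iff_set_decode: "qbit i k \<longleftrightarrow> k \<in> set_decode i"
  by (simp add: qbit_def set_decode_def)

lemma qbit_set_encode: "finite X \<Longrightarrow> qbit (set_encode X) k \<longleftrightarrow> k \<in> X"
  by (simp add: qbit_iff_set_decode)

lemma bij_betw_set_encode: "bij_betw set_encode (Pow {..<m}) {..<2 ^ m}"
proof (rule bij_betw_byWitness[where f' = set_decode])
  show "\<forall>X\<in>Pow {..<m}. set_decode (set_encode X) = X"
    using finite_subset[OF _ finite_lessThan] by (metis PowD set_encode_inverse)
  have "set_encode X < 2 ^ m" if "X \<subseteq> {..<m}" for X
  proof -
    have "set_encode X \<le> (\<Sum>k<m. 2 ^ k)"
      unfolding set_encode_def using that by (intro sum_mono2) auto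
    also have "\<dots> < 2 ^ m" unfolding lessThan_atLeast0 sum_power2 by simp
    finally show ?thesis .
  qed
  then show "set_encode ` Pow {..<m} \<subseteq> {..<2 ^ m}" by auto
  have "k < m" if "i < 2 ^ m" "k \<in> set_decode i" for i k
  proof (rule ccontr)
    assume "\<not> k < m"
    then have "(2 :: nat) ^ m \<le> 2 ^ k" by simp
    with that(1) have "i < 2 ^ k" by linarith
    then show False using that(2) by (simp add: set_decode_def)
  qed
  then show "set_decode ` {..<2 ^ m} \<subseteq> Pow {..<m}" by auto
qed simp_all

lemma set_encode_less: "X \<subseteq> {..<m} \<Longrightarrow> set_encode X < 2 ^ m"
  using bij_betw_set_encode[of m] by (auto simp: bij_betw_def)

lemma sum_set_encode: "(\<Sum>i<2 ^ m. f i) = (\<Sum>X\<in>Pow {..<m}. f (set_encode X))"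
  using sum.reindex_bij_betw[OF bij_betw_set_encode, of f m] by simp

lemma set_entry_mult:
  assumes "A \<in> carrier_mat (2 ^ m) (2 ^ m)" "B \<in> carrier_mat (2 ^ m) (2 ^ m)"
    "X \<subseteq> {..<m}" "Y \<subseteq> {..<m}"
  shows "set_entry (A * B) X Y = (\<Sum>Z\<in>Pow {..<m}. set_entry A X Z * set_entry B Z Y)"
  using assms set_encode_less[OF assms(3)] set_encode_less[OF assms(4)]
  by (simp add: set_entry_def scalar_prod_def atLeast0LessThan sum_set_encode set_encode_less)

lemma index_mat_adjoint:
  assumes "A \<in> carrier_mat N N" "i < N" "j < N"
  shows "mat_adjoint A $$ (i, j) = cnj (A $$ (j, i))"
  using assms by (auto simp: mat_adjoint_def mat_of_rows_index)

lemma set_entry_adjoint: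
  assumes "A \<in> carrier_mat (2 ^ m) (2 ^ m)" "X \<subseteq> {..<m}" "Y \<subseteq> {..<m}"
  shows "set_entry (mat_adjoint A) X Y = cnj (set_entry A Y X)"
  using assms by (simp add: set_entry_def index_mat_adjoint set_encode_less)

lemma col_orthonormal_unitary:
  assumes "unitary_mat 2 v"
  shows "col_orthonormal (\<lambda>b c. v $$ (if b then 1 else 0, if c then 1 else 0))"
  unfolding col_orthonormal_def
proof (intro allI)
  fix c c' :: bool
  let ?i = "\<lambda>c. if c then 1 else 0 :: nat"
  have v: "v \<in> carrier_mat 2 2" and eq: "mat_adjoint v * v = 1\<^sub>m 2"
    using assms by (auto simp: unitary_mat_def)
  have lt: "?i c < 2" "?i c' < 2" by auto
  have adj: "mat_adjoint v \<in> carrier_mat 2 2" using v by (auto simp: mat_adjoint_def)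
  have "(mat_adjoint v * v) $$ (?i c', ?i c) = (\<Sum>k<2. mat_adjoint v $$ (?i c', k) * v $$ (k, ?i c))"
    using v adj lt by (simp add: scalar_prod_def atLeast0LessThan)
  also have "\<dots> = (\<Sum>k<2. cnj (v $$ (k, ?i c')) * v $$ (k, ?i c))"
    using lt by (intro sum.cong refl) (simp add: index_mat_adjoint[OF v])
  also have "\<dots> = v $$ (1, ?i c) * cnj (v $$ (1, ?i c')) + v $$ (0, ?i c) * cnj (v $$ (0, ?i c'))"
    by (simp only: numeral_2_eq_2 sum.lessThan_Suc lessThan_0 sum.empty One_nat_def) (simp only: ac_simps add_0_left)
  finally have "(1\<^sub>m 2 :: complex mat) $$ (?i c', ?i c) =
      v $$ (1, ?i c) * cnj (v $$ (1, ?i c')) + v $$ (0, ?i c) * cnj (v $$ (0, ?i c'))"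
    unfolding eq .
  moreover have "(1\<^sub>m 2 :: complex mat) $$ (?i c', ?i c) = of_bool (c = c')"
    by (cases c; cases c') simp_all
  ultimately show "v $$ (?i True, ?i c) * cnj (v $$ (?i True, ?i c')) + v $$ (?i False, ?i c) * cnj (v $$ (?i False, ?i c')) =
      of_bool (c = c')"
    by (simp only: if_True if_False)
qed

lemma set_entry_single_qubit_layer:
  assumes "X \<subseteq> {..<m}" "Y \<subseteq> {..<m}"
  shows "set_entry (single_qubit_layer m u) X Y =
    tensor_on {..<m} (\<lambda>k b c. u k $$ (if b then 1 else 0, if c then 1 else 0)) X Y"
  using set_encode_less[OF assms(1)] set_encode_less[OF assms(2)]
    finite_subset[OF assms(1)] finite_subset[OF assms(2)]
  by (simp add: set_entry_def single_qubit_layer_def qbit_set_encode tensor_on_def)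

lemma set_entry_cz_layer:
  assumes "X \<subseteq> {..<m}" "Y \<subseteq> {..<m}"
  shows "set_entry (cz_layer m F) X Y = (if X = Y then complex_of_real (\<Prod>T\<in>F. cz_sign T X) else 0)"
proof -
  have fin: "finite X" "finite Y" using assms finite_subset by blast+
  have *: "(\<Prod>T\<in>F. if \<forall>k\<in>T. qbit (set_encode X) k then - 1 else 1 :: complex) =
     complex_of_real (\<Prod>T\<in>F. cz_sign T X)"
    unfolding of_real_prod
    by (intro prod.cong refl) (auto simp: qbit_set_encode[OF fin(1)] cz_sign_def)
  have "set_entry (cz_layer m F) X Y = (if X = Y then
      (\<Prod>T\<in>F. if \<forall>k\<in>T. qbit (set_encode X) k then - 1 else 1) else 0)"
    using set_encode_less[OF assms(1)] set_encode_less[OF assms(2)]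
    by (simp only: set_entry_def cz_layer_def index_mat prod.case set_encode_eq[OF fin])
  then show ?thesis unfolding * .
qed

lemma set_entry_qac0_compose:
  assumes L: "\<And>i. i \<le> d \<Longrightarrow> L i = single_qubit_layer m (u i)"
    and M: "\<And>i. i \<in> {1..d} \<Longrightarrow> M i = cz_layer m (F i)"
  defines "Lf \<equiv> \<lambda>i. tensor_on {..<m} (\<lambda>k b c. u i k $$ (if b then 1 else 0, if c then 1 else 0))"
  shows "qac0_compose L M d \<in> carrier_mat (2 ^ m) (2 ^ m)"
    and "X \<subseteq> {..<m} \<Longrightarrow> Y \<subseteq> {..<m} \<Longrightarrow>
      set_entry (qac0_compose L M d) X Y = fcirc m Lf (\<lambda>i X. \<Prod>T\<in>F i. cz_sign T X) d X Y"
proof -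
  have "qac0_compose L M j \<in> carrier_mat (2 ^ m) (2 ^ m) \<and> (\<forall>X\<subseteq>{..<m}. \<forall>Y\<subseteq>{..<m}.
      set_entry (qac0_compose L M j) X Y = fcirc m Lf (\<lambda>i X. \<Prod>T\<in>F i. cz_sign T X) j X Y)" if "j \<le> d" for j
    using that
  proof (induction j)
    case 0
    then show ?case
      using L[of 0] by (auto simp: set_entry_single_qubit_layer Lf_def) (simp add: single_qubit_layer_def)
  next
    case (Suc j)
    have Lj: "L (Suc j) = single_qubit_layer m (u (Suc j))" using L Suc.prems by blast
    have Mj: "M (Suc j) = cz_layer m (F (Suc j))" using M[of "Suc j"] Suc.prems by auto
    have Lc: "L (Suc j) \<in> carrier_mat (2 ^ m) (2 ^ m)" by (simp add: Lj single_qubit_layer_def)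
    have Mc: "M (Suc j) \<in> carrier_mat (2 ^ m) (2 ^ m)" by (simp add: Mj cz_layer_def)
    have IH: "qac0_compose L M j \<in> carrier_mat (2 ^ m) (2 ^ m)"
      "\<And>X Y. X \<subseteq> {..<m} \<Longrightarrow> Y \<subseteq> {..<m} \<Longrightarrow>
        set_entry (qac0_compose L M j) X Y = fcirc m Lf (\<lambda>i X. \<Prod>T\<in>F i. cz_sign T X) j X Y"
      using Suc by auto
    \<comment> \<open>Reassociated to the right, to match the recursion of
      \<open>fcirc\<close>.\<close>
    have comp: "qac0_compose L M (Suc j) = L (Suc j) * (M (Suc j) * qac0_compose L M j)"
      using assoc_mult_mat[OF Lc Mc IH(1)] by simp
    have "set_entry (qac0_compose L M (Suc j)) X Y = fcirc m Lf (\<lambda>i X. \<Prod>T\<in>F i. cz_sign T X) (Suc j) X Y"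
      if XY: "X \<subseteq> {..<m}" "Y \<subseteq> {..<m}" for X Y
    proof -
      have inner: "set_entry (M (Suc j) * qac0_compose L M j) Z Y =
          complex_of_real (\<Prod>T\<in>F (Suc j). cz_sign T Z) * fcirc m Lf (\<lambda>i X. \<Prod>T\<in>F i. cz_sign T X) j Z Y"
        if Z: "Z \<in> Pow {..<m}" for Z
      proof -
        have "set_entry (M (Suc j) * qac0_compose L M j) Z Y =
          (\<Sum>Z'\<in>Pow {..<m}. set_entry (M (Suc j)) Z Z' * set_entry (qac0_compose L M j) Z' Y)"
          using Z XY by (intro set_entry_mult[OF Mc IH(1)]) auto
        also have "\<dots> = (\<Sum>Z'\<in>Pow {..<m}. if Z = Z' then
            complex_of_real (\<Prod>T\<in>F (Suc j). cz_sign T Z) * set_entry (qac0_compose L M j) Z' Y else 0)"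
          using Z by (intro sum.cong refl) (simp add: Mj set_entry_cz_layer)
        also have "\<dots> = complex_of_real (\<Prod>T\<in>F (Suc j). cz_sign T Z) * set_entry (qac0_compose L M j) Z Y"
          using Z by (simp add: sum.delta')
        finally show ?thesis using Z XY IH(2) by simp
      qed
      show ?thesis
        unfolding comp set_entry_mult[OF Lc mult_carrier_mat[OF Mc IH(1)] XY] fcirc.simps
        by (intro sum.cong refl) (use XY in \<open>simp add: inner Lj set_entry_single_qubit_layer Lf_def\<close>)
    qed
    moreover have "qac0_compose L M (Suc j) \<in> carrier_mat (2 ^ m) (2 ^ m)"
      unfolding comp by (rule mult_carrier_mat[OF Lc mult_carrier_mat[OF Mc IH(1)]])
    ultimately show ?case by blast
  qed
  from this[of d] show "qac0_compose L M d \<in> carrier_mat (2 ^ m) (2 ^ m)"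
    "X \<subseteq> {..<m} \<Longrightarrow> Y \<subseteq> {..<m} \<Longrightarrow>
      set_entry (qac0_compose L M d) X Y = fcirc m Lf (\<lambda>i X. \<Prod>T\<in>F i. cz_sign T X) d X Y" by auto
qed

section \<open>Acceptance probability as a seminorm\<close>

lemma set_encode_with_ancilla_div:
  assumes "x \<subseteq> {..<n}" "finite I"
  shows "set_encode (with_ancilla n x I) div 2 ^ n = set_encode I"
proof -
  let ?e = "set_encode (with_ancilla n x I)"
  have fin: "finite (with_ancilla n x I)" using assms finite_subset by (auto simp: with_ancilla_def)
  have "k \<in> set_decode (?e div 2 ^ n) \<longleftrightarrow> k \<in> I" for k
  proof -
    have "k \<in> set_decode (?e div 2 ^ n) \<longleftrightarrow> qbit ?e (n + k)"
      by (simp add: set_decode_def qbit_def div_mult2_eq power_add)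
    also have "\<dots> \<longleftrightarrow> n + k \<in> with_ancilla n x I" by (rule qbit_set_encode[OF fin])
    also have "\<dots> \<longleftrightarrow> k \<in> I" using assms by (auto simp: with_ancilla_def)
    finally show ?thesis .
  qed
  then have "set_decode (?e div 2 ^ n) = I" by blast
  then show ?thesis using set_decode_inverse[of "?e div 2 ^ n"] by simp
qed

lemma sum_with_ancilla:
  assumes "x \<subseteq> {..<n}"
  shows "(\<Sum>Y\<in>Pow {..<n + a}. if Y \<inter> {..<n} = x then f Y else 0) =
    (\<Sum>I\<in>Pow {..<a}. f (with_ancilla n x I))"
proof -
  have "(\<Sum>Y\<in>Pow {..<n + a}. if Y \<inter> {..<n} = x then f Y else 0) =
    (\<Sum>Y\<in>{Y \<in> Pow {..<n + a}. Y \<inter> {..<n} = x}. f Y)"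
    by (rule sum.inter_filter[symmetric]) simp
  also have "\<dots> = (\<Sum>I\<in>Pow {..<a}. f (with_ancilla n x I))"
  proof (rule sum.reindex_bij_witness[of _ "with_ancilla n x" "\<lambda>Y. {k. k + n \<in> Y}"])
    fix Y assume Y: "Y \<in> {Y \<in> Pow {..<n + a}. Y \<inter> {..<n} = x}"
    show "with_ancilla n x {k. k + n \<in> Y} = Y"
    proof (intro subset_antisym subsetI)
      fix i assume "i \<in> Y"
      then show "i \<in> with_ancilla n x {k. k + n \<in> Y}"
        using Y by (cases "i < n") (auto simp: with_ancilla_def image_iff intro!: exI[of _ "i - n"])
    qed (use Y in \<open>auto simp: with_ancilla_def\<close>)
    then show "f (with_ancilla n x {k. k + n \<in> Y}) = f Y" by simp
    show "{k. k + n \<in> Y} \<in> Pow {..<a}" using Y by auto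
  qed (use assms in \<open>auto simp: with_ancilla_def\<close>)
  finally show ?thesis .
qed

text \<open>Only index pairs with input part \<open>x\<close> contribute to the conjugated input
  state. Reindexing them by ancilla states leaves a quadratic form in \<open>\<phi>\<close>, and the
  output projection restricts the trace to rows containing qubit 0.\<close>

lemma accept_prob_eq_sqnorm:
  assumes U: "U \<in> carrier_mat (2 ^ (n + a)) (2 ^ (n + a))" and x: "x \<subseteq> {..<n}"
  shows "accept_prob n a U \<phi> x = sqnorm a (set_entry \<phi>) {X \<in> Pow {..<n + a}. 0 \<in> X}
     (\<lambda>X I. set_entry U X (with_ancilla n x I))"
proof -
  define m where "m = n + a"
  let ?M = "Pow {..<m}" and ?N = "2 ^ m :: nat"
  let ?R = "input_state n a x \<phi>" and ?P = "proj_one m"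
  have U: "U \<in> carrier_mat ?N ?N" using U by (simp add: m_def)
  have R: "?R \<in> carrier_mat ?N ?N" by (simp add: input_state_def m_def)
  have P: "?P \<in> carrier_mat ?N ?N" by (simp add: proj_one_def)
  have Ua: "mat_adjoint U \<in> carrier_mat ?N ?N" using U by (auto simp: mat_adjoint_def)
  have UR: "U * ?R \<in> carrier_mat ?N ?N" using U R by simp
  have B: "U * ?R * mat_adjoint U \<in> carrier_mat ?N ?N" using UR Ua by simp
  have fin: "finite X" if "X \<subseteq> {..<m}" for X using that finite_subset by blast
  have Pe: "set_entry ?P X Y = (if X = Y then of_bool (0 \<in> X) else 0)" if "X \<subseteq> {..<m}" "Y \<subseteq> {..<m}" for X Y
    using that by (simp add: set_entry_def proj_one_def set_encode_less qbit_set_encode fin set_encode_eq)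
  have Re: "set_entry ?R Y Z = (if Y \<inter> {..<n} = x then (if Z \<inter> {..<n} = x then
      \<phi> $$ (set_encode Y div 2 ^ n, set_encode Z div 2 ^ n) else 0) else 0)"
    if YZ: "Y \<subseteq> {..<m}" "Z \<subseteq> {..<m}" for Y Z
  proof -
    have "(\<forall>k<n. (k \<in> Y \<longleftrightarrow> k \<in> x) \<and> (k \<in> Z \<longleftrightarrow> k \<in> x)) \<longleftrightarrow> Y \<inter> {..<n} = x \<and> Z \<inter> {..<n} = x"
      using x by blast
    then show ?thesis
      using YZ set_encode_less[OF YZ(1)] set_encode_less[OF YZ(2)]
      by (simp add: set_entry_def input_state_def m_def[symmetric] qbit_set_encode fin)
  qed
  have Be: "set_entry (U * ?R * mat_adjoint U) X X =
      qform a (set_entry \<phi>) (\<lambda>I. set_entry U X (with_ancilla n x I)) (\<lambda>I. set_entry U X (with_ancilla n x I))"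
    if X: "X \<subseteq> {..<m}" for X
  proof -
    have finA: "finite I" if "I \<in> Pow {..<a}" for I using that finite_subset by blast
    have "set_entry (U * ?R * mat_adjoint U) X X =
      (\<Sum>Z\<in>?M. (\<Sum>Y\<in>?M. set_entry U X Y * set_entry ?R Y Z) * cnj (set_entry U X Z))"
      unfolding set_entry_mult[OF UR Ua X X]
      by (intro sum.cong refl) (simp add: set_entry_mult[OF U R] set_entry_adjoint[OF U] X)
    also have "\<dots> = (\<Sum>Y\<in>?M. \<Sum>Z\<in>?M. set_entry U X Y * set_entry ?R Y Z * cnj (set_entry U X Z))"
      unfolding sum_distrib_right by (rule sum.swap)
    also have "\<dots> = (\<Sum>Y\<in>?M. if Y \<inter> {..<n} = x then (\<Sum>Z\<in>?M. if Z \<inter> {..<n} = x then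
        set_entry U X Y * \<phi> $$ (set_encode Y div 2 ^ n, set_encode Z div 2 ^ n) * cnj (set_entry U X Z) else 0) else 0)"
      by (intro sum.cong refl) (auto simp: Re intro!: sum.cong sum.neutral)
    also have "\<dots> = (\<Sum>I\<in>Pow {..<a}. \<Sum>J\<in>Pow {..<a}. set_entry U X (with_ancilla n x I) *
        \<phi> $$ (set_encode (with_ancilla n x I) div 2 ^ n, set_encode (with_ancilla n x J) div 2 ^ n) *
        cnj (set_entry U X (with_ancilla n x J)))"
      unfolding m_def by (simp only: sum_with_ancilla[OF x])
    also have "\<dots> = qform a (set_entry \<phi>) (\<lambda>I. set_entry U X (with_ancilla n x I)) (\<lambda>I. set_entry U X (with_ancilla n x I))"
      unfolding qform_def set_entry_def
      by (intro sum.cong refl) (simp only: set_encode_with_ancilla_div[OF x finA])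
    finally show ?thesis .
  qed
  have "mtrace (?P * (U * ?R * mat_adjoint U)) = (\<Sum>X\<in>?M. set_entry (?P * (U * ?R * mat_adjoint U)) X X)"
    using P by (simp add: mtrace_def set_entry_def sum_set_encode proj_one_def)
  also have "\<dots> = (\<Sum>X\<in>?M. if 0 \<in> X then set_entry (U * ?R * mat_adjoint U) X X else 0)"
  proof (intro sum.cong refl)
    fix X assume X: "X \<in> ?M"
    then have "set_entry (?P * (U * ?R * mat_adjoint U)) X X =
      (\<Sum>Z\<in>?M. set_entry ?P X Z * set_entry (U * ?R * mat_adjoint U) Z X)"
      by (intro set_entry_mult[OF P B]) auto
    also have "\<dots> = (\<Sum>Z\<in>?M. if X = Z then (if 0 \<in> X then set_entry (U * ?R * mat_adjoint U) Z X else 0) else 0)"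
      using X by (intro sum.cong refl) (auto simp: Pe)
    also have "\<dots> = (if 0 \<in> X then set_entry (U * ?R * mat_adjoint U) X X else 0)"
      using X by (simp add: sum.delta')
    finally show "set_entry (?P * (U * ?R * mat_adjoint U)) X X = \<dots>" .
  qed
  also have "\<dots> = (\<Sum>X\<in>{X \<in> ?M. 0 \<in> X}. set_entry (U * ?R * mat_adjoint U) X X)"
    by (rule sum.inter_filter[symmetric]) simp
  finally show ?thesis
    unfolding accept_prob_def sqnorm_def m_def[symmetric] by (simp add: Be)
qed

lemma density_operator_psd:
  assumes "density_operator a \<phi>"
  shows "psd_kernel a (set_entry \<phi>)" and "Re (\<Sum>I\<in>Pow {..<a}. set_entry \<phi> I I) = 1"
proof -
  have \<phi>: "\<phi> \<in> carrier_mat (2 ^ a) (2 ^ a)" and tr: "mtrace \<phi> = 1"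
    and psd: "\<And>v. v \<in> carrier_vec (2 ^ a) \<Longrightarrow> 0 \<le> (\<phi> *\<^sub>v v) \<bullet>c v"
    using assms by (auto simp: density_operator_def)
  show "psd_kernel a (set_entry \<phi>)"
  proof
    fix v :: "nat set \<Rightarrow> complex"
    \<comment> \<open>Conjugated, since \<open>qform\<close> conjugates the vector at the column
      index of the matrix, whereas \<open>\<bullet>c\<close> conjugates the one at the row
      index.\<close>
    define w where "w = vec (2 ^ a) (\<lambda>i. cnj (v (set_decode i)))"
    have wI: "w $ set_encode I = cnj (v I)" if "I \<in> Pow {..<a}" for I
    proof -
      have "I \<subseteq> {..<a}" "finite I" using that finite_subset by blast+
      then show ?thesis by (simp add: w_def set_encode_less)
    qed
    have "(\<phi> *\<^sub>v w) \<bullet>c w = (\<Sum>i<2 ^ a. (\<Sum>j<2 ^ a. \<phi> $$ (i, j) * w $ j) * cnj (w $ i))"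
      using \<phi> by (simp add: scalar_prod_def w_def atLeast0LessThan)
    also have "\<dots> = (\<Sum>I\<in>Pow {..<a}. (\<Sum>J\<in>Pow {..<a}. \<phi> $$ (set_encode I, set_encode J) * cnj (v J)) * v I)"
      unfolding sum_set_encode
      by (intro sum.cong refl) (simp add: wI)
    also have "\<dots> = qform a (set_entry \<phi>) v v"
      unfolding qform_def set_entry_def sum_distrib_right by (intro sum.cong refl) (simp add: ac_simps)
    finally have "qform a (set_entry \<phi>) v v \<ge> 0" using psd[of w] by (simp add: w_def)
    then show "0 \<le> Re (qform a (set_entry \<phi>) v v)" by (simp add: less_eq_complex_def)
  qed
  have "mtrace \<phi> = (\<Sum>I\<in>Pow {..<a}. set_entry \<phi> I I)"
    using \<phi> by (simp add: mtrace_def set_entry_def sum_set_encode)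
  then show "Re (\<Sum>I\<in>Pow {..<a}. set_entry \<phi> I I) = 1" using tr by simp
qed

section \<open>Assembly of the bound and choice of parameters\<close>

text \<open>In the assumption on \<open>\<epsilon>\<close>, \<open>real (n + a) * 2 / 4 ^ l\<close>
  is the error of one layer, \<open>d\<close> counts the layers and the leading 2 comes from
  \<open>sqnorm_diff_le\<close>. The output observable has degree 1, hence \<open>1 / K'\<close> in
  the bound.\<close>

lemma accept_prob_approx_deg:
  fixes K K' :: real
  assumes n: "n \<ge> 1" and circ: "qac0_circuit (n + a) d U" and dens: "density_operator a \<phi>"
    and K: "8 * real l * real (n + a) \<le> K" "real (n + a) \<le> K" and K': "K' = 2 powr (3/2) * K"
    and \<epsilon>: "2 * (real d * (real (n + a) * 2 / 4 ^ l)) \<le> \<epsilon>"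
  shows "real (approx_deg n \<epsilon> (accept_prob n a U \<phi>)) \<le> K' * (1 / K') powr (1 / 3 ^ d)"
proof -
  define m where "m = n + a"
  have K0: "K > 0" using n K(2) by linarith
  obtain L M where LM: "\<forall>i\<le>d. is_single_qubit_layer m (L i)" "\<forall>i\<in>{1..d}. is_cz_layer m (M i)"
    and U: "U = qac0_compose L M d"
    using circ unfolding qac0_circuit_def m_def by blast
  from LM(1) obtain u where u: "\<And>i. i \<le> d \<Longrightarrow> \<forall>k<m. unitary_mat 2 (u i k)"
    "\<And>i. i \<le> d \<Longrightarrow> L i = single_qubit_layer m (u i)"
    unfolding is_single_qubit_layer_def by metis
  from LM(2) obtain F where F: "\<And>i. i \<in> {1..d} \<Longrightarrow> \<forall>S\<in>F i. S \<noteq> {} \<and> S \<subseteq> {..<m}"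
    "\<And>i. i \<in> {1..d} \<Longrightarrow> \<forall>S\<in>F i. \<forall>T\<in>F i. S \<noteq> T \<longrightarrow> S \<inter> T = {}"
    "\<And>i. i \<in> {1..d} \<Longrightarrow> M i = cz_layer m (F i)"
    unfolding is_cz_layer_def by metis
  define Lf where "Lf = (\<lambda>i. tensor_on {..<m} (\<lambda>k b c. u i k $$ (if b then 1 else 0, if c then 1 else 0)))"
  define g where "g = (\<lambda>i X. \<Prod>T\<in>F i. cz_sign T X)"
  have Lf: "\<exists>v. (\<forall>k<m. col_orthonormal (v k)) \<and> Lf i = tensor_on {..<m} v" if "i \<le> d" for i
    unfolding Lf_def using u(1)[OF that] col_orthonormal_unitary
    by (intro exI[of _ "\<lambda>k b c. u i k $$ (if b then 1 else 0, if c then 1 else 0)"]) simp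
  have Uc: "U \<in> carrier_mat (2 ^ m) (2 ^ m)"
    unfolding U by (rule set_entry_qac0_compose(1)[where u = u and F = F]) (use u F in auto)
  have Ue: "set_entry U X Y = fcirc m Lf g d X Y" if "X \<subseteq> {..<m}" "Y \<subseteq> {..<m}" for X Y
    unfolding U Lf_def g_def
    by (rule set_entry_qac0_compose(2)[where u = u and F = F]) (use u F that in auto)
  define \<delta> where "\<delta> = real m * 2 / 4 ^ l"
  obtain h where h: "\<And>i X. i \<in> {1..d} \<Longrightarrow> \<bar>h i X\<bar> \<le> 1"
    "\<And>i X. i \<in> {1..d} \<Longrightarrow> \<bar>h i X - g i X\<bar> \<le> \<delta>"
    "\<And>A. opdeg m 1 A \<Longrightarrow> opdeg m (K' * (1 / K') powr (1 / 3 ^ d)) (heis m (fcirc m Lf h d) A)"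
  proof (rule circuit_approx[where m = m and d = d and L = Lf and F = F and y = 1 and l = l and K = K, OF Lf _ _ _ _ K0 K'])
    show "T \<subseteq> {..<m}" if "i \<in> {1..d}" "T \<in> F i" for i T using F(1)[OF that(1)] that by blast
    show "T \<inter> T' = {}" if "i \<in> {1..d}" "T \<in> F i" "T' \<in> F i" "T \<noteq> T'" for i T T'
      using F(2)[OF that(1)] that by blast
    show "8 * real l * real m \<le> K" "real m \<le> K" using K by (simp_all add: m_def)
  qed (assumption, simp, rule that[unfolded g_def \<delta>_def])
  have g1: "\<bar>g i X\<bar> \<le> 1" for i X
    unfolding g_def abs_prod by (rule prod_le_1) (auto simp: cz_sign_def)
  let ?\<Phi> = "set_entry \<phi>" and ?\<X> = "{X \<in> Pow {..<m}. 0 \<in> X}"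
  let ?O = "\<lambda>X X'. of_bool (X = X' \<and> X \<in> ?\<X>) :: complex"
  \<comment> \<open>The counterpart of the acceptance probability for the approximate circuit, in
    Heisenberg form so that its Fourier degree can be read off.\<close>
  define q where "q x = Re (\<Sum>I\<in>Pow {..<a}. \<Sum>J\<in>Pow {..<a}.
     heis m (fcirc m Lf h d) ?O (with_ancilla n x I) (with_ancilla n x J) * ?\<Phi> I J)" for x
  interpret psd_kernel a ?\<Phi> by (rule density_operator_psd[OF dens])
  have "opdeg m 1 ?O"
    by (rule opdeg.supported[OF _ _ supported_on_output]) (use n in \<open>auto simp: m_def\<close>)
  note deg = h(3)[OF this]
  have close: "\<bar>accept_prob n a U \<phi> x - q x\<bar> \<le> \<epsilon>" if x: "x \<subseteq> {..<n}" for x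
  proof -
    let ?\<iota> = "with_ancilla n x"
    have \<iota>: "inj_on ?\<iota> (Pow {..<a})" "?\<iota> ` Pow {..<a} \<subseteq> Pow {..<m}"
      using inj_on_with_ancilla[OF x] with_ancilla_subset[OF x] by (auto simp: m_def)
    have tr: "Re (\<Sum>I\<in>Pow {..<a}. ?\<Phi> I I) = 1" by (rule density_operator_psd[OF dens])
    have "accept_prob n a U \<phi> x = sqnorm a ?\<Phi> ?\<X> (\<lambda>X I. set_entry U X (?\<iota> I))"
      using accept_prob_eq_sqnorm[of U n a x \<phi>] Uc x by (simp add: m_def)
    also have "\<dots> = sqnorm a ?\<Phi> ?\<X> (\<lambda>X I. fcirc m Lf g d X (?\<iota> I))"
      unfolding sqnorm_def qform_def using \<iota>(2)
      by (intro sum.cong refl arg_cong[where f = Re]) (simp add: Ue image_subset_iff)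
    finally have p: "accept_prob n a U \<phi> x = sqnorm a ?\<Phi> ?\<X> (\<lambda>X I. fcirc m Lf g d X (?\<iota> I))" .
    have q: "q x = sqnorm a ?\<Phi> ?\<X> (\<lambda>X I. fcirc m Lf h d X (?\<iota> I))"
      unfolding q_def by (rule sqnorm_eq_heis[symmetric]) blast
    have hg: "\<bar>g i X - h i X\<bar> \<le> \<delta>" "\<bar>h i X - g i X\<bar> \<le> \<delta>" if "i \<in> {1..d}" for i X
      using h(2)[OF that, of X] by (simp_all add: abs_minus_commute)
    have "\<bar>accept_prob n a U \<phi> x - q x\<bar> \<le> 2 * (real d * \<delta>)"
      unfolding p q
    proof (rule sqnorm_diff_le[of _ "Pow {..<m}"])
      show "sqrt (sqnorm a ?\<Phi> (Pow {..<m}) (\<lambda>X I. fcirc m Lf g d X (?\<iota> I))) \<le> 1"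
        by (rule fcirc_close(1)[OF Lf g1 h(1) hg(1) \<iota> tr])
      show "sqrt (sqnorm a ?\<Phi> (Pow {..<m}) (\<lambda>X I. fcirc m Lf h d X (?\<iota> I))) \<le> 1"
        by (rule fcirc_close(1)[OF Lf h(1) g1 hg(2) \<iota> tr])
      show "sqrt (sqnorm a ?\<Phi> (Pow {..<m})
          (\<lambda>X I. fcirc m Lf g d X (?\<iota> I) - fcirc m Lf h d X (?\<iota> I))) \<le> real d * \<delta>"
        by (rule fcirc_close(2)[OF Lf g1 h(1) hg(1) \<iota> tr])
    qed auto
    with \<epsilon> show ?thesis by (simp add: \<delta>_def m_def)
  qed
  show ?thesis
  proof (rule approx_deg_le[where g = q])
    show "0 \<le> K' * (1 / K') powr (1 / 3 ^ d)" using K' K0 by simp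
    show "fourier_coeff n q T = 0" if "T \<subseteq> {..<n}" "K' * (1 / K') powr (1 / 3 ^ d) < real (card T)" for T
      using fourier_coeff_opdeg[OF deg[unfolded m_def] that, of ?\<Phi>] unfolding q_def m_def .
  qed (rule close)
qed

theorem theorem4p1:
  shows "\<exists>C c (k::nat). C > 0 \<and> c > 0 \<and>
    (\<forall>n a d U \<phi>. n \<ge> 1 \<longrightarrow> qac0_circuit (n + a) d U \<longrightarrow> density_operator a \<phi> \<longrightarrow>
       real (approx_deg n (c * real d / real n) (accept_prob n a U \<phi>))
         \<le> C * real (n + a) powr (1 - 1 / 3 ^ d) * (1 + ln (real (n + a))) ^ k)"
proof (rule exI[of _ 48], rule exI[of _ 1], rule exI[of _ 1], intro conjI allI impI)
  fix n a d U \<phi>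
  assume n: "n \<ge> 1" and circ: "qac0_circuit (n + a) d U" and dens: "density_operator a \<phi>"
  define N where "N = real (n + a)"
  \<comment> \<open>Ensures \<open>2 ^ l \<ge> 2 * N\<close>, so that
    \<open>4 ^ l \<ge> 4 * N\<^sup>2\<close> and the total error \<open>4 * d * N / 4 ^ l\<close> is
    at most \<open>d / N \<le> d / n\<close>.\<close>
  define l where "l = nat \<lceil>log 2 (2 * N)\<rceil>"
  \<comment> \<open>Dominates \<open>8 * l * N\<close>, as
    \<open>l \<le> 2 * (1 + ln N)\<close>.\<close>
  define K where "K = 16 * N * (1 + ln N)"
  define K' where "K' = 2 powr (3/2) * K"
  define e :: real where "e = 1 / 3 ^ d"
  have N: "N \<ge> 1" "real n \<le> N" using n by (simp_all add: N_def)
  have lnN: "ln N \<ge> 0" using N by simp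
  have e: "0 < e" "e \<le> 1" by (simp_all add: e_def)
  have ln2: "ln 2 \<ge> (1/2 :: real)" using ln_le_minus_one[of "1/2 :: real"] by (simp add: ln_div)
  have l: "real l \<le> 2 * (1 + ln N)"
  proof -
    have "log 2 (2 * N) = 1 + ln N / ln 2" using N by (simp add: log_def ln_mult add_divide_distrib)
    moreover have "ln N / ln 2 \<le> ln N / (1/2)" using ln2 lnN by (intro divide_left_mono) auto
    ultimately have "log 2 (2 * N) \<le> 1 + 2 * ln N" by simp
    moreover have "0 \<le> log 2 (2 * N)" using N by simp
    then have "real l = of_int \<lceil>log 2 (2 * N)\<rceil>"
      unfolding l_def by (intro of_nat_nat) (simp add: order.strict_trans2[of "- 1"])
    then have "real l \<le> log 2 (2 * N) + 1" by simp
    ultimately show ?thesis by argo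
  qed
  have l4: "4 * (N * N) \<le> 4 ^ l"
  proof -
    have "2 * N = 2 powr log 2 (2 * N)" using N by simp
    also have "\<dots> \<le> 2 powr real l" by (intro powr_mono) (simp_all add: l_def real_nat_ceiling_ge)
    also have "\<dots> = 2 ^ l" by (simp add: powr_realpow)
    finally have "(2 * N) * (2 * N) \<le> 2 ^ l * 2 ^ l" using N by (intro mult_mono) auto
    then show ?thesis by (simp flip: power_mult_distrib)
  qed
  have err: "2 * (real d * (N * 2 / 4 ^ l)) \<le> 1 * real d / real n"
  proof -
    have "N * 2 / 4 ^ l \<le> N * 2 / (4 * (N * N))" using l4 N by (intro divide_left_mono) auto
    also have "\<dots> = 1 / (2 * N)" using N by simp
    also have "\<dots> \<le> 1 / (2 * real n)" using N n by (intro divide_left_mono) auto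
    finally have "2 * (real d * (N * 2 / 4 ^ l)) \<le> 2 * (real d * (1 / (2 * real n)))"
      by (intro mult_left_mono) auto
    then show ?thesis by simp
  qed
  have K1: "8 * real l * N \<le> K"
  proof -
    have "8 * N * real l \<le> 8 * N * (2 * (1 + ln N))" using l N by (intro mult_left_mono) auto
    then show ?thesis by (simp add: K_def ac_simps)
  qed
  have "N * 1 \<le> N * (16 * (1 + ln N))" using N lnN by (intro mult_left_mono) auto
  then have K2: "N \<le> K" by (simp add: K_def ac_simps)
  have K0: "K > 0" "K' > 0" using K2 N by (simp_all add: K'_def)
  have "real (approx_deg n (1 * real d / real n) (accept_prob n a U \<phi>)) \<le> K' * (1 / K') powr e"
    unfolding e_def
    by (rule accept_prob_approx_deg[OF n circ dens _ _ K'_def, of l]) (use K1 K2 err in \<open>simp_all add: N_def\<close>)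
  also have "\<dots> = K' powr (1 - e)" using K0 by (simp add: powr_diff powr_divide)
  also have "\<dots> \<le> (48 * (1 + ln N) * N) powr (1 - e)"
  proof (rule powr_mono2)
    \<comment> \<open>The square is 8, below 9. The final constant 48 is this 3 times the 16 in
      \<open>K\<close>.\<close>
    have "2 powr (3/2) \<le> (3 :: real)"
    proof (rule power2_le_imp_le)
      show "(2 powr (3/2))\<^sup>2 \<le> (3 :: real)\<^sup>2" by (simp flip: powr_realpow add: powr_powr)
    qed simp
    then have "K' \<le> 3 * K" unfolding K'_def using K0 by (intro mult_right_mono) auto
    then show "K' \<le> 48 * (1 + ln N) * N" by (simp add: K_def algebra_simps)
  qed (use K0 e in auto)
  also have "\<dots> = (48 * (1 + ln N)) powr (1 - e) * N powr (1 - e)"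
    by (rule powr_mult)
  \<comment> \<open>The base is at least 1, so raising its exponent to 1 is safe and makes the
    logarithmic factor independent of \<open>d\<close>.\<close>
  also have "\<dots> \<le> (48 * (1 + ln N)) powr 1 * N powr (1 - e)"
    using e lnN by (intro mult_right_mono powr_mono) auto
  also have "\<dots> = 48 * N powr (1 - e) * (1 + ln N) ^ 1" using lnN by simp
  finally show "real (approx_deg n (1 * real d / real n) (accept_prob n a U \<phi>))
      \<le> 48 * real (n + a) powr (1 - 1 / 3 ^ d) * (1 + ln (real (n + a))) ^ 1"
    by (simp only: N_def e_def)
qed simp_all

end
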